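(* Let $f:\mathbb{R}^n\times\mathbb{R}^m\to\mathbb{R}$ and $g:\mathbb{R}^n\times\mathbb{R}^m\to\mathbb{R}^p$ be twice continuously differentiable, $K(x):=\{y\in\mathbb{R}^m\mid g(x,y)\le0\}$, $\varphi(x):=\min\{f(x,y)\mid y\in K(x)\}$, $S(x):=\arg\min\{f(x,y)\mid y\in K(x)\}$, and let $\bar x\in\mathbb{R}^n$. Suppose that $\mathrm{gph}\,K$ is compact and that for all $y\in S(\bar x)$ the Mangasarian-Fromovitz constraint qualification holds at $(\bar x,y)$ (i.e. $\nabla_yg(\bar x,y)^\top u=0$, $u\ge0$, $g(\bar x,y)\le0$, $u^\top g(\bar x,y)=0$ imply $u=0$). Assume further that the maps $S$ and $\Lambda$ are single-valued (i.e. $S=\{s\}$, $\Lambda=\{\lambda\}$) and Lipschitz continuous around $\bar x$ and around $(\bar x,\bar y)$, respectively, where $\bar y:=s(\bar x)$ and $\bar u:=\lambda(\bar x,\bar y)$. Then for $\underline{x}\in\partial\varphi(\bar x)$ and all $\underline{x}^*\in\mathbb{R}^n$, $$\partial^2\varphi(\bar x|\underline{x})(\underline{x}^* )\subseteq\nabla^2_{xx}L(\bar x,\bar y,\bar u)\underline{x}^*+\bigcup_{(\zeta^*_x,\zeta^*_y)\in\partial\langle\nabla_xg(\bar x,\bar y)\underline{x}^*,\,\lambda\rangle(\bar x,\bar y)}\Big[\zeta^*_x+\partial\big\langle\zeta^*_y+\nabla^2_{xy}L(\bar x,\bar y,\bar u)\underline{x}^*,\,s\big\rangle(\bar x)\B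ig].$$
   Context: Notation. $L(x,y,u):=f(x,y)+u^\top g(x,y)$. $\nabla_xg$ ($p\times n$) and $\nabla_yg$ ($p\times m$) are partial Jacobians; $\nabla^2_{xx}L$ is the $n\times n$ Hessian in $x$; $\nabla^2_{xy}L$ is the $m\times n$ matrix with entries $\partial^2L/\partial y_i\partial x_j$. Lagrange multiplier map $\Lambda:\mathbb{R}^{n+m}\rightrightarrows\mathbb{R}^p$: $\Lambda(x,y):=\{u\in\mathbb{R}^p\mid\nabla_yL(x,y,u)=0,\ u\ge0,\ g(x,y)\le0,\ u^\top g(x,y)=0\}$. Normal cone. For closed $C\subseteq\mathbb{R}^d$ and $\bar z\in C$, $\widehat N_C(\bar z):=\{v\mid \langle v,z-\bar z\rangle\le o(\|z-\bar z\|)\ \forall z\in C\}$, and $N_C(\bar z):=\{v\mid\exists v_k\to v,\ z_k\to\bar z,\ z_k\in C,\ v_k\in\widehat N_C(z_k)\}$ (Mordukhovich normal cone). Coderivative: $D^*\Psi(\bar x|\bar y)(y^* ):=\{x^*\mid(x^*,-y^* )\in N_{\mathrm{gph}\,\Psi}(\bar x,\bar y)\}$. For a locally Lipschitz real function $\psi$, $\partial\psi(\bar x):=\{\xi\mid(\xi,-1)\in N_{\mathrm{epi}\,\psi}(\bar x,\psi(\bar x))\}$ (Mordukhovich subdifferential); the Clarke subdifferential is its convex hull. $\partial\langle v,s\rangle(\bar x)$ and $\partial\langle w,\lambda\rangle(\bar x,\bar y)$ are the Mordukhovich subdifferentials of $x\mapsto\sum_iv_is_i(x)$ at $\bar x$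 and $(x,y)\mapsto\sum_jw_j\lambda_j(x,y)$ at $(\bar x,\bar y)$. For the value function, $\partial\varphi$ is its Clarke subdifferential and $\partial^2\varphi(\bar x|\underline{x})(\underline{x}^* ):=D^*(\partial\varphi)(\bar x|\underline{x})(\underline{x}^* )$ for $\underline{x}\in\partial\varphi(\bar x)$. *)

theory Defs
  imports "HOL-Analysis.Analysis"
begin

definition twice_continuously_differentiable ::
    "('a::real_normed_vector \<Rightarrow> 'b::real_normed_vector) \<Rightarrow> bool" where
  "twice_continuously_differentiable h \<longleftrightarrow>
     (\<exists>(h' :: 'a \<Rightarrow> 'a \<Rightarrow>\<^sub>L 'b) (h'' :: 'a \<Rightarrow> 'a \<Rightarrow>\<^sub>L ('a \<Rightarrow>\<^sub>L 'b)).
        (\<forall>z. (h has_derivative blinfun_apply (h' z)) (at z)) \<and>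
        (\<forall>z. (h' has_derivative blinfun_apply (h'' z)) (at z)) \<and>
        continuous_on UNIV h'')"

definition partial_deriv :: "'n \<Rightarrow> (real ^ 'n \<Rightarrow> real) \<Rightarrow> real ^ 'n \<Rightarrow> real" where
  "partial_deriv i h x = frechet_derivative h (at x) (axis i 1)"

definition gradient :: "(real ^ 'n \<Rightarrow> real) \<Rightarrow> real ^ 'n \<Rightarrow> real ^ 'n" where
  "gradient h x = (\<chi> i. partial_deriv i h x)"

text \<open>Partial Jacobians (\<open>p \<times> n\<close> and \<open>p \<times> m\<close>): \<open>real ^ 'n ^ 'p\<close> has rows indexed by \<open>'p\<close>.\<close>

definition jac_x :: "((real ^ 'n) \<times> (real ^ 'm) \<Rightarrow> real ^ 'p) \<Rightarrow> real ^ 'n \<Rightarrow> real ^ 'm \<Rightarrow> real ^ 'n ^ 'p" where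
  "jac_x g x y = jacobian (\<lambda>x'. g (x', y)) (at x)"

definition jac_y :: "((real ^ 'n) \<times> (real ^ 'm) \<Rightarrow> real ^ 'p) \<Rightarrow> real ^ 'n \<Rightarrow> real ^ 'm \<Rightarrow> real ^ 'm ^ 'p" where
  "jac_y g x y = jacobian (\<lambda>y'. g (x, y')) (at y)"

definition lagrangian ::
    "((real ^ 'n) \<times> (real ^ 'm) \<Rightarrow> real) \<Rightarrow> ((real ^ 'n) \<times> (real ^ 'm) \<Rightarrow> real ^ 'p) \<Rightarrow>
     real ^ 'n \<Rightarrow> real ^ 'm \<Rightarrow> real ^ 'p \<Rightarrow> real" where
  "lagrangian f g x y u = f (x, y) + u \<bullet> g (x, y)"

text \<open>The \<open>(i, j)\<close> entries are \<open>\<partial>\<^sup>2L / \<partial>x\<^sub>i \<partial>x\<^sub>j\<close> and \<open>\<partial>\<^sup>2L / \<partial>y\<^sub>i \<partial>x\<^sub>j\<close>; the mixed block is thus \<open>m \<times> n\<close>.\<close>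

definition hess_xx_L ::
    "((real ^ 'n) \<times> (real ^ 'm) \<Rightarrow> real) \<Rightarrow> ((real ^ 'n) \<times> (real ^ 'm) \<Rightarrow> real ^ 'p) \<Rightarrow>
     real ^ 'n \<Rightarrow> real ^ 'm \<Rightarrow> real ^ 'p \<Rightarrow> real ^ 'n ^ 'n" where
  "hess_xx_L f g x y u =
     (\<chi> i j. partial_deriv i (\<lambda>x'. partial_deriv j (\<lambda>x''. lagrangian f g x'' y u) x') x)"

definition hess_xy_L ::
    "((real ^ 'n) \<times> (real ^ 'm) \<Rightarrow> real) \<Rightarrow> ((real ^ 'n) \<times> (real ^ 'm) \<Rightarrow> real ^ 'p) \<Rightarrow>
     real ^ 'n \<Rightarrow> real ^ 'm \<Rightarrow> real ^ 'p \<Rightarrow> real ^ 'n ^ 'm" where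
  "hess_xy_L f g x y u =
     (\<chi> i j. partial_deriv i (\<lambda>y'. partial_deriv j (\<lambda>x'. lagrangian f g x' y' u) x) y)"

definition gph :: "('a \<Rightarrow> 'b set) \<Rightarrow> ('a \<times> 'b) set" where
  "gph \<Psi> = {(x, y). y \<in> \<Psi> x}"

definition feasible_map :: "((real ^ 'n) \<times> (real ^ 'm) \<Rightarrow> real ^ 'p) \<Rightarrow> real ^ 'n \<Rightarrow> (real ^ 'm) set" where
  "feasible_map g x = {y. g (x, y) \<le> 0}"

text \<open>Where the minimum is not attained (e.g. \<open>feasible_map g x = {}\<close>) the value is
  arbitrary. With a compact graph this happens only at infeasible parameters \<open>x\<close>;
  the constructions below are local, so such \<open>x\<close> away from the reference point do not matter.\<close>

definition value_function ::
    "((real ^ 'n) \<times> (real ^ 'm) \<Rightarrow> real) \<Rightarrow> ((real ^ 'n) \<times> (real ^ 'm) \<Rightarrow> real ^ 'p) \<Rightarrow> real ^ 'n \<Rightarrow> real" where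
  "value_function f g x = (LEAST r. r \<in> (\<lambda>y. f (x, y)) ` feasible_map g x)"

definition solution_map ::
    "((real ^ 'n) \<times> (real ^ 'm) \<Rightarrow> real) \<Rightarrow> ((real ^ 'n) \<times> (real ^ 'm) \<Rightarrow> real ^ 'p) \<Rightarrow>
     real ^ 'n \<Rightarrow> (real ^ 'm) set" where
  "solution_map f g x = {y. is_arg_min (\<lambda>y. f (x, y)) (\<lambda>y. y \<in> feasible_map g x) y}"

definition multiplier_map ::
    "((real ^ 'n) \<times> (real ^ 'm) \<Rightarrow> real) \<Rightarrow> ((real ^ 'n) \<times> (real ^ 'm) \<Rightarrow> real ^ 'p) \<Rightarrow>
     (real ^ 'n) \<times> (real ^ 'm) \<Rightarrow> (real ^ 'p) set" where
  "multiplier_map f g = (\<lambda>(x, y).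
     {u. gradient (\<lambda>y'. lagrangian f g x y' u) y = 0 \<and> 0 \<le> u \<and> g (x, y) \<le> 0 \<and> u \<bullet> g (x, y) = 0})"

definition MFCQ :: "((real ^ 'n) \<times> (real ^ 'm) \<Rightarrow> real ^ 'p) \<Rightarrow> real ^ 'n \<Rightarrow> real ^ 'm \<Rightarrow> bool" where
  "MFCQ g x y \<longleftrightarrow>
     (\<forall>u. transpose (jac_y g x y) *v u = 0 \<and> 0 \<le> u \<and> g (x, y) \<le> 0 \<and> u \<bullet> g (x, y) = 0 \<longrightarrow> u = 0)"

definition solution_map_single_lipschitz_around ::
    "((real ^ 'n) \<times> (real ^ 'm) \<Rightarrow> real) \<Rightarrow> ((real ^ 'n) \<times> (real ^ 'm) \<Rightarrow> real ^ 'p) \<Rightarrow>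
     (real ^ 'n \<Rightarrow> real ^ 'm) \<Rightarrow> real ^ 'n \<Rightarrow> bool" where
  "solution_map_single_lipschitz_around f g s x0 \<longleftrightarrow>
     (\<exists>U C. open U \<and> x0 \<in> U \<and> (\<forall>x\<in>U. solution_map f g x = {s x}) \<and> C-lipschitz_on U s)"

text \<open>
  The equation \<open>\<Lambda> = {\<lambda>}\<close> is required only on the domain of the multiplier map \<open>\<Lambda>\<close> (the pairs
  possessing a multiplier), while \<open>\<lambda>\<close> itself is defined and Lipschitz on a full neighbourhood, as is
  needed for the subdifferentials of \<open>\<langle>w, \<lambda>\<rangle>\<close>. Requiring \<open>\<Lambda> z = {\<lambda> z}\<close> for all \<open>z\<close> near
  \<open>(x0, s x0)\<close> implies this condition, but would be unsatisfiable together with the other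
  hypotheses of the theorem: all such \<open>z\<close> would be feasible, so an active constraint would have a
  local maximum at \<open>(x0, s x0)\<close>, contradicting MFCQ; hence no constraint is active, multipliers
  vanish, \<open>\<nabla>\<^sub>y f = 0\<close> near \<open>(x0, s x0)\<close>, and minimizers at \<open>x0\<close> are not unique.\<close>

definition multiplier_map_single_lipschitz_around ::
    "((real ^ 'n) \<times> (real ^ 'm) \<Rightarrow> real) \<Rightarrow> ((real ^ 'n) \<times> (real ^ 'm) \<Rightarrow> real ^ 'p) \<Rightarrow>
     ((real ^ 'n) \<times> (real ^ 'm) \<Rightarrow> real ^ 'p) \<Rightarrow> (real ^ 'n) \<times> (real ^ 'm) \<Rightarrow> bool" where
  "multiplier_map_single_lipschitz_around f g l z0 \<longleftrightarrow>
     (\<exists>U C. open U \<and> z0 \<in> U \<and>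
        (\<forall>z\<in>U. multiplier_map f g z \<noteq> {} \<longrightarrow> multiplier_map f g z = {l z}) \<and> C-lipschitz_on U l)"

definition frechet_normal_cone :: "'a::euclidean_space set \<Rightarrow> 'a \<Rightarrow> 'a set" where
  "frechet_normal_cone C zb =
     {v. \<forall>\<epsilon>>0. \<forall>\<^sub>F z in at zb within C. v \<bullet> (z - zb) \<le> \<epsilon> * norm (z - zb)}"

definition normal_cone :: "'a::euclidean_space set \<Rightarrow> 'a \<Rightarrow> 'a set" where
  "normal_cone C zb =
     {v. zb \<in> C \<and> (\<exists>vs zs. vs \<longlonglongrightarrow> v \<and> zs \<longlonglongrightarrow> zb \<and>
            (\<forall>k. zs k \<in> C \<and> vs k \<in> frechet_normal_cone C (zs k)))}"

definition coderivative ::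
    "('a::euclidean_space \<Rightarrow> 'b::euclidean_space set) \<Rightarrow> 'a \<Rightarrow> 'b \<Rightarrow> 'b \<Rightarrow> 'a set" where
  "coderivative \<Psi> xb yb ys = {xs. (xs, - ys) \<in> normal_cone (gph \<Psi>) (xb, yb)}"

definition mordukhovich_subdiff :: "('a::euclidean_space \<Rightarrow> real) \<Rightarrow> 'a \<Rightarrow> 'a set" where
  "mordukhovich_subdiff \<psi> xb = {\<xi>. (\<xi>, - 1) \<in> normal_cone (epigraph UNIV \<psi>) (xb, \<psi> xb)}"

definition clarke_subdiff :: "('a::euclidean_space \<Rightarrow> real) \<Rightarrow> 'a \<Rightarrow> 'a set" where
  "clarke_subdiff \<psi> xb = convex hull (mordukhovich_subdiff \<psi> xb)"

definition second_order_subdiff :: "('a::euclidean_space \<Rightarrow> real) \<Rightarrow> 'a \<Rightarrow> 'a \<Rightarrow> 'a \<Rightarrow> 'a set" where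
  "second_order_subdiff \<psi> xb xu xs = coderivative (clarke_subdiff \<psi>) xb xu xs"

end

theory Submission
  imports Defs
begin

text \<open>Near \<open>xbar\<close> the value function \<open>\<phi>\<close> is differentiable with gradient
  \<open>h x = \<nabla>\<^sub>x L (x, s x, \<lambda> (x, s x))\<close>: MFCQ is stable under perturbation and yields multipliers at
  \<open>(x, s x)\<close>, and \<open>\<phi>\<close> is squeezed between increments of the Lagrangian. As \<open>h\<close> is Lipschitz, elements of
  the coderivative of \<open>\<partial>\<phi> = {h}\<close> in direction \<open>xs\<close> are limiting subgradients of \<open>\<langle>xs, h\<rangle>\<close>. Up to terms with
  arbitrarily small Lipschitz constant, \<open>\<langle>xs, h\<rangle>\<close> is \<open>\<langle>\<nabla>\<^sub>x\<^sub>x L xs, x\<rangle>\<close> plus \<open>q (x, s x)\<close> with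
  \<open>q (x, y) = \<langle>\<nabla>\<^sub>x\<^sub>y L xs, y\<rangle> + \<langle>\<nabla>\<^sub>x g xs, \<lambda> (x, y)\<rangle>\<close>, and a penalty argument gives the chain rule for
  \<open>q (x, s x)\<close>.

  In finite dimensions limiting subgradients may be taken as limits of \<open>\<epsilon>\<close>-subgradients
  with \<open>\<epsilon> \<longlonglongrightarrow> 0\<close>, which makes them robust under perturbations.\<close>

section \<open>Limiting subgradients\<close>

text \<open>Neither \<open>s\<close> nor \<open>l\<close> need be differentiable, and the sets in
  the conclusion are defined by Frechet normals to epigraphs, which tolerate no error. A calculus of
  exact subgradients would need a fuzzy sum rule for each nonsmooth remainder. With a tolerance
  built in, a remainder whose Lipschitz constant near the point is \<delta> merely raises the
  tolerance by \<delta>. This is why coefficients may be frozen at \<open>(xbar, ybar)\<close> and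
  why the conclusion involves matrices at that point only. The way back to exact normals is a
  variational principle: on a compact ball a quadratic perturbation attains its minimum and yields a
  proximal subgradient nearby.

  The other obstacle is that \<open>l z\<close> is known to be a multiplier only where some
  multiplier exists. Existence at \<open>(x, s x)\<close> for all \<open>x\<close> near
  \<open>xbar\<close>, not just at \<open>xbar\<close>, is therefore proved: the coderivative
  depends on the graph of the subdifferential around its base point, so the gradient formula is
  needed on a whole neighbourhood.\<close>

definition approx_subgradient :: "('a::euclidean_space \<Rightarrow> real) \<Rightarrow> real \<Rightarrow> 'a \<Rightarrow> 'a \<Rightarrow> bool" where
  "approx_subgradient \<psi> \<epsilon> x v \<longleftrightarrow>
     (\<forall>\<^sub>F z in nhds x. v \<bullet> (z - x) - \<epsilon> * norm (z - x) \<le> \<psi> z - \<psi> x)"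

text \<open>The vector \<open>v\<close> stays fixed while point and tolerance vary: a sequence
  converging to \<open>v\<close> is absorbed into the tolerance by
  \<open>approx_subgradient_perturb\<close>. Convergence of the values is left to the continuity of
  \<open>\<psi>\<close>.\<close>

definition limiting_subgradient :: "('a::euclidean_space \<Rightarrow> real) \<Rightarrow> 'a \<Rightarrow> 'a \<Rightarrow> bool" where
  "limiting_subgradient \<psi> xb v \<longleftrightarrow> (\<forall>\<epsilon>>0. \<exists>x. dist x xb < \<epsilon> \<and> approx_subgradient \<psi> \<epsilon> x v)"

lemma eventually_nhds_norm_less:
  fixes x :: "'a::real_normed_vector"
  shows "\<delta> > 0 \<Longrightarrow> \<forall>\<^sub>F z in nhds x. norm (z - x) < \<delta>"
  unfolding eventually_nhds_metric dist_norm by blast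

lemma eventually_quadratic_le_linear:
  fixes x :: "'a::real_normed_vector"
  assumes "\<epsilon> > 0"
  shows "\<forall>\<^sub>F z in nhds x. c * (norm (z - x))\<^sup>2 \<le> \<epsilon> * norm (z - x)"
proof -
  have "\<epsilon> / (\<bar>c\<bar> + 1) > 0" using assms by simp
  from eventually_nhds_norm_less[OF this] show ?thesis
  proof eventually_elim
    case (elim z)
    then have "(\<bar>c\<bar> + 1) * norm (z - x) \<le> \<epsilon>"
      by (simp add: field_simps)
    moreover have "c * norm (z - x) \<le> (\<bar>c\<bar> + 1) * norm (z - x)"
      by (intro mult_right_mono) auto
    ultimately have "c * norm (z - x) \<le> \<epsilon>" by linarith
    then show ?case
      by (simp add: power2_eq_square mult.assoc[symmetric] mult_right_mono)
  qed
qed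

lemma approx_subgradient_quadraticI:
  assumes "\<forall>\<^sub>F z in nhds x. v \<bullet> (z - x) - c * (norm (z - x))\<^sup>2 \<le> \<psi> z - \<psi> x" and "\<epsilon> > 0"
  shows "approx_subgradient \<psi> \<epsilon> x v"
  unfolding approx_subgradient_def
  using assms(1) eventually_quadratic_le_linear[OF assms(2), of c x]
  by eventually_elim linarith

text \<open>Replaces a sum rule: the part of \<open>\<psi>' - \<psi>\<close> beyond its linear term
  \<open>w\<close> contributes no subgradient of its own and is charged to the tolerance.\<close>

lemma approx_subgradient_add:
  assumes "approx_subgradient \<psi> \<epsilon> x v"
    and "\<forall>\<^sub>F z in nhds x. \<bar>\<psi>' z - \<psi>' x - (\<psi> z - \<psi> x) - w \<bullet> (z - x)\<bar> \<le> \<delta> * norm (z - x)"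
  shows "approx_subgradient \<psi>' (\<epsilon> + \<delta>) x (v + w)"
  unfolding approx_subgradient_def
  using assms(1)[unfolded approx_subgradient_def] assms(2)
proof eventually_elim
  case (elim z)
  then show ?case unfolding inner_add_left distrib_right abs_le_iff by linarith
qed

lemma approx_subgradient_perturb:
  assumes "approx_subgradient \<psi> \<epsilon> x v" and "norm (v' - v) \<le> \<delta>"
  shows "approx_subgradient \<psi> (\<epsilon> + \<delta>) x v'"
  unfolding approx_subgradient_def
  using assms(1)[unfolded approx_subgradient_def]
proof eventually_elim
  case (elim z)
  have "(v' - v) \<bullet> (z - x) \<le> norm (v' - v) * norm (z - x)" by (rule norm_cauchy_schwarz)
  also have "\<dots> \<le> \<delta> * norm (z - x)" using assms(2) by (intro mult_right_mono) auto
  finally show ?case using elim by (simp add: algebra_simps)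
qed

lemma approx_subgradient_mono:
  assumes "approx_subgradient \<psi> \<epsilon> x v" and "\<epsilon> \<le> \<epsilon>'"
  shows "approx_subgradient \<psi> \<epsilon>' x v"
  using approx_subgradient_perturb[OF assms(1), of v "\<epsilon>' - \<epsilon>"] assms(2) by simp

text \<open>At \<open>x\<close> itself no exact subgradient near \<open>v\<close> need exist.
  Minimizing \<open>\<psi>\<close> minus the linear term plus a quadratic centred at
  \<open>x\<close> moves to a nearby point where the quadratic alone bounds \<open>\<psi>\<close>
  from below.\<close>

lemma approx_subgradient_imp_proximal:
  fixes \<psi> :: "'a::euclidean_space \<Rightarrow> real"
  assumes "open U" "x \<in> U" "continuous_on U \<psi>" and sub: "approx_subgradient \<psi> \<epsilon> x v"
    and "\<epsilon> > 0" "\<delta> > 0"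
  obtains y w c where "dist y x < \<delta>" "norm (w - v) \<le> 2 * \<epsilon>"
    "\<forall>\<^sub>F z in nhds y. w \<bullet> (z - y) - c * (norm (z - y))\<^sup>2 \<le> \<psi> z - \<psi> y"
proof -
  have "\<forall>\<^sub>F z in nhds x. z \<in> U \<and> dist z x < \<delta> \<and>
      v \<bullet> (z - x) - \<epsilon> * norm (z - x) \<le> \<psi> z - \<psi> x"
    using sub[unfolded approx_subgradient_def] eventually_nhds_in_open[OF assms(1,2)]
      eventually_nhds_norm_less[OF \<open>\<delta> > 0\<close>, of x]
    by eventually_elim (auto simp: dist_norm)
  then obtain r where r: "r > 0"
    and ball: "\<And>z. dist z x < r \<Longrightarrow> z \<in> U \<and> dist z x < \<delta> \<and>
      v \<bullet> (z - x) - \<epsilon> * norm (z - x) \<le> \<psi> z - \<psi> x"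
    unfolding eventually_nhds_metric by blast
  define K where "K = cball x (r / 2)"
  \<comment> \<open>Comparing the minimizer \<open>y\<close> with \<open>x\<close> gives
    \<open>c * norm (y - x) \<le> \<epsilon>\<close>. This value of \<open>c\<close> turns it into
    \<open>norm (y - x) \<le> r / 4\<close>, so \<open>y\<close> is interior to the ball of radius
    \<open>r / 2\<close> and competes with all nearby points.\<close>
  define c where "c = 4 * \<epsilon> / r"
  have "c > 0" using r \<open>\<epsilon> > 0\<close> by (simp add: c_def)
  define P where "P z = \<psi> z - v \<bullet> (z - x) + c * (norm (z - x))\<^sup>2" for z
  have KU: "K \<subseteq> U" using ball r by (auto simp: K_def dist_commute)
  have "continuous_on K P"
    unfolding P_def by (intro continuous_intros continuous_on_subset[OF assms(3) KU])
  moreover have "compact K" "K \<noteq> {}" using r by (auto simp: K_def)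
  ultimately obtain y where y: "y \<in> K" and min: "\<And>z. z \<in> K \<Longrightarrow> P y \<le> P z"
    using continuous_attains_inf[of K P] by blast
  have "dist y x < r" using y r by (auto simp: K_def dist_commute)
  note yb = ball[OF this]
  have "P y \<le> P x" using min r by (auto simp: K_def)
  then have "c * (norm (y - x))\<^sup>2 \<le> \<epsilon> * norm (y - x)"
    using yb by (simp add: P_def)
  then have le: "c * norm (y - x) \<le> \<epsilon>"
    using \<open>\<epsilon> > 0\<close> by (cases "y = x") (auto simp: power2_eq_square)
  then have "norm (y - x) \<le> r / 4"
    using r \<open>\<epsilon> > 0\<close> by (simp add: c_def field_simps)
  then have yint: "y \<in> ball x (r / 2)" using r by (simp add: dist_norm norm_minus_commute)
  \<comment> \<open>\<open>v\<close> minus the gradient at \<open>y\<close> of the quadratic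
    term.\<close>
  define w where "w = v - (2 * c) *\<^sub>R (y - x)"
  have "norm (w - v) \<le> 2 * \<epsilon>" using le \<open>c > 0\<close> by (simp add: w_def)
  moreover have "\<forall>\<^sub>F z in nhds y. w \<bullet> (z - y) - c * (norm (z - y))\<^sup>2 \<le> \<psi> z - \<psi> y"
    using eventually_nhds_in_open[OF open_ball yint]
  proof eventually_elim
    case (elim z)
    then have "P y \<le> P z" using min by (auto simp: K_def)
    then show ?case
      by (simp add: P_def w_def power2_norm_eq_inner algebra_simps inner_commute)
  qed
  ultimately show thesis using that yb by blast
qed

text \<open>A point of the epigraph lies on or above the graph, and the component -1 of the normal
  makes extra height only lower the inner product.\<close>

lemma proximal_imp_frechet_normal_epigraph:
  assumes "\<forall>\<^sub>F z in nhds y. w \<bullet> (z - y) - c * (norm (z - y))\<^sup>2 \<le> \<psi> z - \<psi> y"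
  shows "(w, - 1) \<in> frechet_normal_cone (epigraph UNIV \<psi>) (y, \<psi> y)"
  unfolding frechet_normal_cone_def
proof (intro CollectI allI impI)
  fix \<epsilon> :: real assume "\<epsilon> > 0"
  from approx_subgradient_quadraticI[OF assms this]
  have "\<forall>\<^sub>F z in nhds y. w \<bullet> (z - y) - \<epsilon> * norm (z - y) \<le> \<psi> z - \<psi> y"
    by (simp add: approx_subgradient_def)
  moreover have "filterlim fst (nhds y) (at (y, \<psi> y) within epigraph UNIV \<psi>)"
    using tendsto_fst[OF tendsto_ident_at[of "(y, \<psi> y)" "epigraph UNIV \<psi>"]] by simp
  ultimately have "\<forall>\<^sub>F p in at (y, \<psi> y) within epigraph UNIV \<psi>.
      w \<bullet> (fst p - y) - \<epsilon> * norm (fst p - y) \<le> \<psi> (fst p) - \<psi> y"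
    by (rule eventually_compose_filterlim)
  moreover have "\<forall>\<^sub>F p in at (y, \<psi> y) within epigraph UNIV \<psi>. p \<in> epigraph UNIV \<psi>"
    by (simp add: eventually_at_filter)
  ultimately show "\<forall>\<^sub>F p in at (y, \<psi> y) within epigraph UNIV \<psi>.
      (w, - 1) \<bullet> (p - (y, \<psi> y)) \<le> \<epsilon> * norm (p - (y, \<psi> y))"
  proof eventually_elim
    case (elim p)
    have "norm (fst p - y) \<le> norm (p - (y, \<psi> y))"
      by (cases p) (simp add: norm_fst_le)
    then have "\<epsilon> * norm (fst p - y) \<le> \<epsilon> * norm (p - (y, \<psi> y))"
      using \<open>\<epsilon> > 0\<close> by simp
    moreover have "\<psi> (fst p) \<le> snd p" using elim by (auto simp: epigraph_def)
    ultimately show ?case using elim by (simp add: inner_prod_def)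
  qed
qed

lemma tendsto_of_dist_le:
  assumes "\<And>k. dist (y k) a \<le> e k" and "(e \<longlongrightarrow> (0::real)) F"
  shows "(y \<longlongrightarrow> a) F"
  using assms(2) by (rule metric_tendsto_imp_tendsto)
    (simp add: dist_real_def always_eventually order_trans[OF assms(1) abs_ge_self])

lemma limiting_subgradient_imp_mordukhovich:
  assumes "open U" "xb \<in> U" "continuous_on U \<psi>" and lim: "limiting_subgradient \<psi> xb v"
  shows "v \<in> mordukhovich_subdiff \<psi> xb"
proof -
  define e where "e k = 1 / real (Suc k)" for k
  have e0: "e k > 0" for k by (simp add: e_def)
  have elim: "e \<longlonglongrightarrow> 0" unfolding e_def by (rule LIMSEQ_Suc[OF lim_1_over_n])
  obtain r where r: "r > 0" "ball xb r \<subseteq> U" using assms(1,2) openE by blast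
  have "\<exists>y w. dist y xb < 2 * e k \<and> norm (w - v) \<le> 2 * e k \<and>
      (w, - 1) \<in> frechet_normal_cone (epigraph UNIV \<psi>) (y, \<psi> y)" for k
  proof -
    \<comment> \<open>The bound \<open>r\<close> keeps the approximating point in \<open>U\<close>,
      where \<open>\<psi>\<close> is continuous.\<close>
    have "min r (e k) > 0" using r e0 by simp
    then obtain x where x: "dist x xb < min r (e k)" "approx_subgradient \<psi> (min r (e k)) x v"
      using lim unfolding limiting_subgradient_def by blast
    have xU: "x \<in> U" using x r by (auto simp: dist_commute)
    have sub: "approx_subgradient \<psi> (e k) x v" using approx_subgradient_mono[OF x(2)] by simp
    then obtain y w c where y: "dist y x < e k" "norm (w - v) \<le> 2 * e k"
      and prox: "\<forall>\<^sub>F z in nhds y. w \<bullet> (z - y) - c * (norm (z - y))\<^sup>2 \<le> \<psi> z - \<psi> y"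
      using approx_subgradient_imp_proximal[OF assms(1) xU assms(3) sub e0 e0] by blast
    have "dist y xb < 2 * e k" using dist_triangle[of y xb x] x(1) y(1) by simp
    then show ?thesis using y(2) proximal_imp_frechet_normal_epigraph[OF prox] by blast
  qed
  then obtain y w where y: "\<And>k. dist (y k) xb < 2 * e k" "\<And>k. norm (w k - v) \<le> 2 * e k"
    and N: "\<And>k. (w k, - 1) \<in> frechet_normal_cone (epigraph UNIV \<psi>) (y k, \<psi> (y k))"
    by metis
  have e2: "(\<lambda>k. 2 * e k) \<longlonglongrightarrow> 0" using tendsto_mult[OF tendsto_const[of 2] elim] by simp
  have ylim: "y \<longlonglongrightarrow> xb" using y(1) by (intro tendsto_of_dist_le[OF _ e2] less_imp_le)
  have wlim: "w \<longlonglongrightarrow> v" using y(2) by (intro tendsto_of_dist_le[OF _ e2]) (simp add: dist_norm)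
  have "isCont \<psi> xb" using assms(1-3) continuous_on_eq_continuous_at by blast
  then have "(\<lambda>k. \<psi> (y k)) \<longlonglongrightarrow> \<psi> xb" using ylim by (rule isCont_tendsto_compose)
  then have "(\<lambda>k. (y k, \<psi> (y k))) \<longlonglongrightarrow> (xb, \<psi> xb)" using ylim by (intro tendsto_Pair)
  moreover have "(\<lambda>k. (w k, - 1 :: real)) \<longlonglongrightarrow> (v, - 1)" using wlim by (intro tendsto_intros)
  ultimately have "(v, - 1) \<in> normal_cone (epigraph UNIV \<psi>) (xb, \<psi> xb)"
    unfolding normal_cone_def using N
    by (intro CollectI conjI exI[of _ "\<lambda>k. (w k, - 1)"] exI[of _ "\<lambda>k. (y k, \<psi> (y k))"])
      (simp_all add: epigraph_def)
  then show ?thesis by (simp add: mordukhovich_subdiff_def)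
qed

section \<open>Chain rule for Lipschitz compositions\<close>

text \<open>The constraint \<open>z' = (x, s x)\<close> is relaxed by the penalty \<open>t * (norm (z' - (x, s x)))\<^sup>2\<close>. At a
  minimizer the gradient of the penalty in \<open>z'\<close> is a subgradient \<open>\<zeta>\<close> of \<open>q\<close>, and minimality in \<open>x\<close>
  turns it into a subgradient of \<open>\<langle>snd \<zeta>, s\<rangle>\<close>.\<close>

lemma approx_subgradient_chain:
  fixes s :: "'a::euclidean_space \<Rightarrow> 'b::euclidean_space" and q :: "'a \<times> 'b \<Rightarrow> real"
  assumes "open U" "L-lipschitz_on U s" "x0 \<in> U"
    and "open V" "K-lipschitz_on V q" "(x0, s x0) \<in> V"
    and sub: "approx_subgradient (\<lambda>x. q (x, s x)) \<epsilon> x0 v" and "\<epsilon> > 0" "\<delta> > 0"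
  obtains x z \<zeta> where "dist x x0 < \<delta>" "dist z (x0, s x0) < \<delta>" "norm \<zeta> \<le> 2 * K"
    "approx_subgradient q \<epsilon> z \<zeta>"
    "approx_subgradient (\<lambda>x. snd \<zeta> \<bullet> s x) (3 * \<epsilon>) x (v - fst \<zeta>)"
proof -
  note Ls = lipschitz_onD[OF assms(2)] and Lq = lipschitz_onD[OF assms(5)]
  have L0: "L \<ge> 0" and K0: "K \<ge> 0"
    using assms(2,5) lipschitz_on_nonneg by blast+
  have s_cont: "continuous_on U s" and q_cont: "continuous_on V q"
    using assms(2,5) lipschitz_on_continuous_on by blast+
  have isCont: "isCont s x0" using s_cont assms(1,3) continuous_on_eq_continuous_at by blast
  have conv: "((\<lambda>x. (x, s x)) \<longlongrightarrow> (x0, s x0)) (nhds x0)"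
    using isCont by (intro tendsto_intros filterlim_ident) (simp add: continuous_at tendsto_at_iff_tendsto_nhds)
  obtain r1 where r1: "r1 > 0" "cball (x0, s x0) r1 \<subseteq> V"
    using assms(4,6) open_contains_cball by blast
  have "\<forall>\<^sub>F x in nhds x0. x \<in> U \<and> dist (x, s x) (x0, s x0) < min \<delta> r1 / 2 \<and>
      v \<bullet> (x - x0) - \<epsilon> * norm (x - x0) \<le> q (x, s x) - q (x0, s x0)"
    using eventually_nhds_in_open[OF assms(1,3)] sub[unfolded approx_subgradient_def]
      tendstoD[OF conv, of "min \<delta> r1 / 2"] \<open>\<delta> > 0\<close> r1(1)
    by (auto elim: eventually_elim2 simp: eventually_conj_iff)
  then obtain r2 where r2: "r2 > 0" and near: "\<And>x. dist x x0 < r2 \<Longrightarrow> x \<in> U \<and>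
      dist (x, s x) (x0, s x0) < min \<delta> r1 / 2 \<and>
      v \<bullet> (x - x0) - \<epsilon> * norm (x - x0) \<le> q (x, s x) - q (x0, s x0)"
    unfolding eventually_nhds_metric by blast
  define r where "r = min \<delta> r2 / 2"
  have r: "r > 0" using \<open>\<delta> > 0\<close> r2 by (simp add: r_def)
  define A where "A = cball x0 r \<times> cball (x0, s x0) r1"
  have A_near: "x \<in> cball x0 r \<Longrightarrow> dist x x0 < r2" for x
    using r2 \<open>\<delta> > 0\<close> by (auto simp: r_def dist_commute)
  \<comment> \<open>The penalized minimizer satisfies \<open>t * d \<le> K\<close> and
    \<open>\<epsilon> * norm (x - x0) \<le> K * d\<close>, with \<open>d\<close> its constraint
    violation. The summand with \<open>K\<^sup>2\<close> then keeps \<open>x\<close> inside its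
    ball, the other one keeps \<open>z\<close> inside its ball, and the 1 makes both bounds
    strict.\<close>
  define t where "t = 1 + 2 * (K\<^sup>2 / (\<epsilon> * r) + K / min \<delta> r1)"
  have "t > 0" using K0 \<open>\<epsilon> > 0\<close> r \<open>\<delta> > 0\<close> r1(1) unfolding t_def
    by (intro add_pos_nonneg mult_nonneg_nonneg add_nonneg_nonneg divide_nonneg_nonneg) auto
  \<comment> \<open>One of the two \<epsilon> pays for the \<epsilon>-subgradient inequality at
    \<open>x0\<close>; the other one survives in \<open>main\<close> and bounds the distance of
    \<open>x\<close> from \<open>x0\<close>. The variable \<open>snd p\<close> carries its own copy
    of the first argument of \<open>q\<close>, which is where \<open>fst \<zeta>\<close> comes
    from.\<close>
  define P where "P p = q (snd p) - v \<bullet> (fst p - x0) + 2 * \<epsilon> * norm (fst p - x0)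
      + t * (norm (snd p - (fst p, s (fst p))))\<^sup>2" for p
  have "continuous_on A (\<lambda>p. q (snd p))"
    by (intro continuous_on_compose2[OF q_cont] continuous_intros) (use r1 in \<open>auto simp: A_def\<close>)
  moreover have "continuous_on A (\<lambda>p. s (fst p))"
    by (intro continuous_on_compose2[OF s_cont] continuous_intros) (use near A_near in \<open>auto simp: A_def\<close>)
  ultimately have "continuous_on A P" unfolding P_def by (intro continuous_intros)
  moreover have "compact A" unfolding A_def by (intro compact_Times compact_cball)
  moreover have in_A: "(x0, (x0, s x0)) \<in> A" using r r1 by (simp add: A_def)
  ultimately obtain p where "p \<in> A" and min: "\<And>p'. p' \<in> A \<Longrightarrow> P p \<le> P p'"
    using continuous_attains_inf[of A P] by (metis empty_iff)
  then obtain x z where xz: "x \<in> cball x0 r" "z \<in> cball (x0, s x0) r1" "p = (x, z)"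
    unfolding A_def by auto
  have nx: "x \<in> U" "dist (x, s x) (x0, s x0) < min \<delta> r1 / 2"
    "v \<bullet> (x - x0) - \<epsilon> * norm (x - x0) \<le> q (x, s x) - q (x0, s x0)"
    using near[OF A_near[OF xz(1)]] by auto
  define d where "d = norm (z - (x, s x))"
  have "(x, s x) \<in> V" "z \<in> V"
    using nx(2) xz(2) r1 \<open>\<delta> > 0\<close> by (auto simp: dist_commute intro!: subsetD[OF r1(2)])
  then have "\<bar>q (x, s x) - q z\<bar> \<le> K * d"
    using Lq[of "(x, s x)" z] by (simp add: dist_real_def dist_norm d_def norm_minus_commute)
  moreover have "P p \<le> P (x0, (x0, s x0))" using min in_A by blast
  ultimately have main: "\<epsilon> * norm (x - x0) + t * d\<^sup>2 \<le> K * d"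
    using nx(3) xz(3) by (simp add: P_def d_def)
  have d0: "d \<ge> 0" by (simp add: d_def)
  have "0 \<le> \<epsilon> * norm (x - x0)" "0 \<le> t * d\<^sup>2" using \<open>\<epsilon> > 0\<close> \<open>t > 0\<close> by simp_all
  with main have "t * d\<^sup>2 \<le> K * d" and x_d: "\<epsilon> * norm (x - x0) \<le> K * d" by linarith+
  then have td: "t * d \<le> K"
  proof (cases "d = 0")
    case False
    with d0 \<open>t * d\<^sup>2 \<le> K * d\<close> have "t * d * d \<le> K * d" "d > 0"
      by (simp_all add: power2_eq_square mult.assoc)
    then show ?thesis by simp
  qed (simp add: K0)
  have "d * t < min \<delta> r1 / 2 * t"
  proof -
    have "K < min \<delta> r1 / 2 * t"
    proof -
      have "K = min \<delta> r1 / 2 * (2 * (K / min \<delta> r1))" using \<open>\<delta> > 0\<close> r1(1) by auto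
      also have "\<dots> < min \<delta> r1 / 2 * t"
        using \<open>\<delta> > 0\<close> r1(1) r \<open>\<epsilon> > 0\<close>
        by (intro mult_strict_left_mono) (auto simp: t_def intro: add_pos_nonneg)
      finally show ?thesis .
    qed
    with td show ?thesis by (simp add: mult.commute)
  qed
  then have d_small: "d < min \<delta> r1 / 2" using \<open>t > 0\<close> by (simp only: mult_less_cancel_right_pos)
  have "norm (x - x0) * (\<epsilon> * t) < r * (\<epsilon> * t)"
  proof -
    have "norm (x - x0) * (\<epsilon> * t) \<le> K * d * t"
      using mult_right_mono[OF x_d, of t] \<open>t > 0\<close> by (simp add: ac_simps)
    also have "\<dots> \<le> K * K" using mult_left_mono[OF td K0] by (simp add: ac_simps)
    also have "\<dots> \<le> r * \<epsilon> * (2 * (K\<^sup>2 / (\<epsilon> * r)))"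
      using r \<open>\<epsilon> > 0\<close> by (simp add: power2_eq_square field_simps)
    also have "\<dots> < r * \<epsilon> * t"
      using \<open>\<delta> > 0\<close> r1(1) r \<open>\<epsilon> > 0\<close> K0
      by (intro mult_strict_left_mono) (auto simp: t_def intro: add_pos_nonneg)
    finally show ?thesis by (simp add: mult.assoc)
  qed
  then have x_int: "norm (x - x0) < r" using \<open>\<epsilon> > 0\<close> \<open>t > 0\<close>
    by (simp only: mult_less_cancel_right_pos mult_pos_pos)
  have "dist z (x0, s x0) \<le> d + dist (x, s x) (x0, s x0)"
    using dist_triangle[of z "(x0, s x0)" "(x, s x)"] by (simp add: d_def dist_norm)
  then have z_int: "dist z (x0, s x0) < min \<delta> r1" using d_small nx(2) by linarith
  \<comment> \<open>Minus the gradient of the penalty at \<open>z\<close>. Varying only the second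
    variable in the minimality of \<open>(x, z)\<close> gives a quadratic minorant of
    \<open>q\<close> with this slope.\<close>
  define \<zeta> where "\<zeta> = - (2 * t) *\<^sub>R (z - (x, s x))"
  have "norm \<zeta> = 2 * t * d" using \<open>t > 0\<close>
    by (simp only: \<zeta>_def norm_scaleR d_def)
  then have \<zeta>_bd: "norm \<zeta> \<le> 2 * K" using td by simp
  have "z \<in> ball (x0, s x0) r1" using z_int by (simp add: dist_commute)
  from eventually_nhds_in_open[OF open_ball this]
  have "\<forall>\<^sub>F z' in nhds z. \<zeta> \<bullet> (z' - z) - t * (norm (z' - z))\<^sup>2 \<le> q z' - q z"
  proof eventually_elim
    case (elim z')
    then have "P (x, z) \<le> P (x, z')" using min xz by (auto simp: A_def)
    moreover have "(norm (z' - (x, s x)))\<^sup>2 = (norm (z - (x, s x)))\<^sup>2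
        + 2 * ((z - (x, s x)) \<bullet> (z' - z)) + (norm (z' - z))\<^sup>2"
      by (simp only: power2_norm_eq_inner inner_diff_left inner_diff_right inner_commute) simp
    ultimately show ?case
      unfolding P_def \<zeta>_def fst_conv snd_conv inner_scaleR_left by (simp add: algebra_simps)
  qed
  from approx_subgradient_quadraticI[OF this \<open>\<epsilon> > 0\<close>] have sub_q: "approx_subgradient q \<epsilon> z \<zeta>" .
  have "x \<in> ball x0 r" using x_int by (simp add: dist_norm norm_minus_commute)
  from eventually_nhds_in_open[OF open_ball this]
    eventually_quadratic_le_linear[OF \<open>\<epsilon> > 0\<close>, of "t * (1 + L)\<^sup>2" x]
  \<comment> \<open>Now \<open>z\<close> is fixed and \<open>x\<close> varies. The tolerance is
    2\<epsilon> from the norm term of \<open>P\<close> plus \<epsilon> for the second-order part of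
    the penalty, which is quadratic in \<open>norm (x' - x)\<close> because \<open>s\<close> is
    Lipschitz.\<close>
  have sub_s: "approx_subgradient (\<lambda>x. snd \<zeta> \<bullet> s x) (3 * \<epsilon>) x (v - fst \<zeta>)"
    unfolding approx_subgradient_def
  proof eventually_elim
    case (elim x')
    define h where "h = (x' - x, s x' - s x)"
    have "x' \<in> U" using elim near A_near by auto
    have "norm h \<le> norm (x' - x) + norm (s x' - s x)"
      unfolding h_def by (rule norm_Pair_le)
    also have "\<dots> \<le> (1 + L) * norm (x' - x)"
      using Ls[OF \<open>x' \<in> U\<close> \<open>x \<in> U\<close>] by (simp add: dist_norm algebra_simps)
    finally have "(norm h)\<^sup>2 \<le> ((1 + L) * norm (x' - x))\<^sup>2" by (rule power_mono) simp
    then have "t * (norm h)\<^sup>2 \<le> t * (1 + L)\<^sup>2 * (norm (x' - x))\<^sup>2"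
      using \<open>t > 0\<close> by (simp add: power_mult_distrib mult.assoc)
    with elim have h_small: "t * (norm h)\<^sup>2 \<le> \<epsilon> * norm (x' - x)" by linarith
    have "P (x, z) \<le> P (x', z)" using elim min xz by (auto simp: A_def)
    moreover have "z - (x', s x') = (z - (x, s x)) - h" by (simp add: h_def prod_eq_iff)
    then have "(norm (z - (x', s x')))\<^sup>2 = (norm (z - (x, s x)))\<^sup>2
        - 2 * ((z - (x, s x)) \<bullet> h) + (norm h)\<^sup>2"
      by (simp only: power2_norm_eq_inner inner_diff_left inner_diff_right inner_commute) simp
    ultimately have "v \<bullet> (x' - x) \<le> 2 * \<epsilon> * (norm (x' - x0) - norm (x - x0)) + \<zeta> \<bullet> h + t * (norm h)\<^sup>2"
      unfolding P_def \<zeta>_def fst_conv snd_conv inner_scaleR_left by (simp add: algebra_simps)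
    moreover have "2 * \<epsilon> * (norm (x' - x0) - norm (x - x0)) \<le> 2 * \<epsilon> * norm (x' - x)"
      using \<open>\<epsilon> > 0\<close> norm_triangle_ineq2[of "x' - x0" "x - x0"] by (intro mult_left_mono) auto
    moreover have "\<zeta> \<bullet> h = fst \<zeta> \<bullet> (x' - x) + (snd \<zeta> \<bullet> s x' - snd \<zeta> \<bullet> s x)"
      by (simp add: h_def inner_prod_def inner_diff_right)
    ultimately show ?case using h_small by (simp add: inner_diff_left)
  qed
  have "dist x x0 < \<delta>" using x_int \<open>\<delta> > 0\<close> by (simp add: dist_norm r_def)
  moreover have "dist z (x0, s x0) < \<delta>" using z_int by simp
  ultimately show thesis using that \<zeta>_bd sub_q sub_s by blast
qed

text \<open>The estimate has to hold for pairs of nearby points: approximate subgradients live at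
  points other than \<open>xb\<close>, so differentiability of the remainder at \<open>xb\<close>
  alone would say nothing there.\<close>

lemma limiting_subgradient_strict_perturb:
  assumes "limiting_subgradient \<psi> xb v"
    and strict: "\<And>\<epsilon>. \<epsilon> > 0 \<Longrightarrow> \<exists>\<delta>>0. \<forall>x\<in>ball xb \<delta>. \<forall>z\<in>ball xb \<delta>.
      \<bar>\<psi>' z - \<psi>' x - (\<psi> z - \<psi> x) - w \<bullet> (z - x)\<bar> \<le> \<epsilon> * norm (z - x)"
  shows "limiting_subgradient \<psi>' xb (v + w)"
  unfolding limiting_subgradient_def
proof (intro allI impI)
  fix \<epsilon> :: real assume "\<epsilon> > 0"
  then obtain \<delta> where "\<delta> > 0" and \<delta>: "\<And>x z. x \<in> ball xb \<delta> \<Longrightarrow> z \<in> ball xb \<delta> \<Longrightarrow>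
      \<bar>\<psi>' z - \<psi>' x - (\<psi> z - \<psi> x) - w \<bullet> (z - x)\<bar> \<le> \<epsilon> / 2 * norm (z - x)"
    using strict[of "\<epsilon> / 2"] by (metis half_gt_zero)
  have "min (\<epsilon> / 2) \<delta> > 0" using \<open>\<epsilon> > 0\<close> \<open>\<delta> > 0\<close> by simp
  then obtain x where x: "dist x xb < min (\<epsilon> / 2) \<delta>" "approx_subgradient \<psi> (min (\<epsilon> / 2) \<delta>) x v"
    using assms(1) unfolding limiting_subgradient_def by blast
  have sub: "approx_subgradient \<psi> (\<epsilon> / 2) x v" using approx_subgradient_mono[OF x(2)] by simp
  have "x \<in> ball xb \<delta>" using x(1) by (simp add: dist_commute)
  from eventually_nhds_in_open[OF open_ball this]
  have "\<forall>\<^sub>F z in nhds x. \<bar>\<psi>' z - \<psi>' x - (\<psi> z - \<psi> x) - w \<bullet> (z - x)\<bar> \<le> \<epsilon> / 2 * norm (z - x)"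
    by eventually_elim (rule \<delta>[OF \<open>x \<in> ball xb \<delta>\<close>])
  from approx_subgradient_add[OF sub this] show "\<exists>x. dist x xb < \<epsilon> \<and> approx_subgradient \<psi>' \<epsilon> x (v + w)"
    using x(1) \<open>\<epsilon> > 0\<close> by (intro exI[of _ x]) simp
qed

text \<open>The approximate chain rule yields slopes bounded by \<open>2 * K\<close>, so they have a
  cluster point. Replacing a slope by that limit changes
  \<open>\<langle>snd \<zeta>, s\<rangle>\<close> by a function whose Lipschitz constant is at most
  \<open>L\<close> times the error, again a matter of tolerance.\<close>

lemma limiting_subgradient_chain:
  fixes s :: "'a::euclidean_space \<Rightarrow> 'b::euclidean_space" and q :: "'a \<times> 'b \<Rightarrow> real"
  assumes "open U" "L-lipschitz_on U s" "xb \<in> U"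
    and "open V" "K-lipschitz_on V q" "(xb, s xb) \<in> V"
    and lim: "limiting_subgradient (\<lambda>x. q (x, s x)) xb v"
  obtains \<zeta> where "limiting_subgradient q (xb, s xb) \<zeta>"
    "limiting_subgradient (\<lambda>x. snd \<zeta> \<bullet> s x) xb (v - fst \<zeta>)"
proof -
  have s_cont: "continuous_on U s" using assms(2) lipschitz_on_continuous_on by blast
  have L0: "L \<ge> 0" using assms(2) lipschitz_on_nonneg by blast
  have "isCont s xb" using s_cont assms(1,3) continuous_on_eq_continuous_at by blast
  then have conv: "((\<lambda>x. (x, s x)) \<longlongrightarrow> (xb, s xb)) (nhds xb)"
    by (intro tendsto_intros filterlim_ident) (simp add: continuous_at tendsto_at_iff_tendsto_nhds)
  define e where "e k = 1 / real (Suc k)" for k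
  have e0: "e k > 0" for k by (simp add: e_def)
  have elim: "e \<longlonglongrightarrow> 0" unfolding e_def by (rule LIMSEQ_Suc[OF lim_1_over_n])
  obtain r where r: "r > 0" "ball xb r \<subseteq> U" using assms(1,3) openE by blast
  have "\<exists>x z \<zeta>. x \<in> U \<and> dist x xb < 2 * e k \<and> dist z (xb, s xb) < 2 * e k \<and> norm \<zeta> \<le> 2 * K \<and>
      approx_subgradient q (3 * e k) z \<zeta> \<and>
      approx_subgradient (\<lambda>x. snd \<zeta> \<bullet> s x) (3 * e k) x (v - fst \<zeta>)" for k
  proof -
    \<comment> \<open>Half of \<open>r\<close>, since the point obtained below lies within
      \<open>2 * \<rho>\<close> of \<open>xb\<close> and must stay in \<open>U\<close>.\<close>
    define \<rho> where "\<rho> = min (e k) (r / 2)"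
    have \<rho>: "\<rho> > 0" "\<rho> \<le> e k" "\<rho> \<le> r / 2" using e0 r by (auto simp: \<rho>_def)
    have "\<forall>\<^sub>F x in nhds xb. (x, s x) \<in> V \<and> dist (x, s x) (xb, s xb) < e k"
      using topological_tendstoD[OF conv assms(4,6)] tendstoD[OF conv e0]
      by (simp add: eventually_conj_iff)
    then obtain \<delta> where \<delta>: "\<delta> > 0" "\<And>x. dist x xb < \<delta> \<Longrightarrow> (x, s x) \<in> V \<and> dist (x, s x) (xb, s xb) < e k"
      unfolding eventually_nhds_metric by blast
    have "min \<rho> \<delta> > 0" using \<rho> \<delta> by simp
    then obtain x0 where x0: "dist x0 xb < min \<rho> \<delta>"
      "approx_subgradient (\<lambda>x. q (x, s x)) (min \<rho> \<delta>) x0 v"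
      using lim unfolding limiting_subgradient_def by blast
    have sub: "approx_subgradient (\<lambda>x. q (x, s x)) \<rho> x0 v"
      using approx_subgradient_mono[OF x0(2)] by simp
    have "x0 \<in> U" using x0(1) \<rho> r by (auto simp: dist_commute)
    moreover have "(x0, s x0) \<in> V" "dist (x0, s x0) (xb, s xb) < e k" using \<delta>(2) x0(1) by auto
    ultimately obtain x z \<zeta> where xz: "dist x x0 < \<rho>" "dist z (x0, s x0) < \<rho>" "norm \<zeta> \<le> 2 * K"
      "approx_subgradient q \<rho> z \<zeta>" "approx_subgradient (\<lambda>x. snd \<zeta> \<bullet> s x) (3 * \<rho>) x (v - fst \<zeta>)"
      using approx_subgradient_chain[OF assms(1,2) _ assms(4,5) _ sub \<rho>(1) \<rho>(1)] by blast
    have "dist x xb < 2 * \<rho>" using dist_triangle[of x xb x0] xz(1) x0(1) by simp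
    moreover have "dist z (xb, s xb) < 2 * e k"
      using dist_triangle[of z "(xb, s xb)" "(x0, s x0)"] xz(2) \<rho>(2) \<open>dist (x0, s x0) (xb, s xb) < e k\<close>
      by linarith
    moreover have "approx_subgradient q (3 * e k) z \<zeta>"
      using approx_subgradient_mono[OF xz(4)] \<rho> e0[of k] by simp
    moreover have "approx_subgradient (\<lambda>x. snd \<zeta> \<bullet> s x) (3 * e k) x (v - fst \<zeta>)"
      using approx_subgradient_mono[OF xz(5)] \<rho> by simp
    moreover have "x \<in> U" using \<open>dist x xb < 2 * \<rho>\<close> \<rho>(3) r by (auto simp: dist_commute)
    ultimately show ?thesis using xz(3) \<rho>(2) by (intro exI[of _ x] exI[of _ z] exI[of _ \<zeta>]) auto
  qed
  then obtain x z \<zeta> where xU: "\<And>k. x k \<in> U" and x: "\<And>k. dist (x k) xb < 2 * e k"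
    and z: "\<And>k. dist (z k) (xb, s xb) < 2 * e k" and bd: "\<And>k. norm (\<zeta> k) \<le> 2 * K"
    and sub_q: "\<And>k. approx_subgradient q (3 * e k) (z k) (\<zeta> k)"
    and sub_s: "\<And>k. approx_subgradient (\<lambda>x. snd (\<zeta> k) \<bullet> s x) (3 * e k) (x k) (v - fst (\<zeta> k))"
    by metis
  have "\<forall>k. \<zeta> k \<in> cball 0 (2 * K)" using bd by simp
  with compact_imp_seq_compact[OF compact_cball] obtain \<zeta>0 \<rho>
    where \<rho>: "strict_mono \<rho>" "(\<zeta> \<circ> \<rho>) \<longlonglongrightarrow> \<zeta>0"
    by (metis seq_compactE)
  have approx: "\<exists>k. 3 * e k < \<epsilon> \<and> norm (\<zeta>0 - \<zeta> k) < \<epsilon>" if "\<epsilon> > 0" for \<epsilon>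
  proof -
    have "(\<lambda>k. 3 * e (\<rho> k)) \<longlonglongrightarrow> 3 * 0"
      using LIMSEQ_subseq_LIMSEQ[OF elim \<rho>(1)] by (intro tendsto_intros) (simp add: o_def)
    then have "\<forall>\<^sub>F k in sequentially. 3 * e (\<rho> k) < \<epsilon>" using that by (intro order_tendstoD) auto
    moreover have "\<forall>\<^sub>F k in sequentially. dist ((\<zeta> \<circ> \<rho>) k) \<zeta>0 < \<epsilon>" using tendstoD[OF \<rho>(2) that] .
    ultimately have "\<forall>\<^sub>F k in sequentially. 3 * e (\<rho> k) < \<epsilon> \<and> norm (\<zeta>0 - \<zeta> (\<rho> k)) < \<epsilon>"
      by eventually_elim (simp add: dist_norm norm_minus_commute)
    then show ?thesis unfolding eventually_sequentially by blast
  qed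
  have "limiting_subgradient q (xb, s xb) \<zeta>0"
    unfolding limiting_subgradient_def
  proof (intro allI impI)
    fix \<epsilon> :: real assume "\<epsilon> > 0"
    then obtain k where k: "3 * e k < \<epsilon> / 2" "norm (\<zeta>0 - \<zeta> k) < \<epsilon> / 2"
      using approx[of "\<epsilon> / 2"] by auto
    have "approx_subgradient q (3 * e k + \<epsilon> / 2) (z k) \<zeta>0"
      using approx_subgradient_perturb[OF sub_q] k(2) by simp
    then have "approx_subgradient q \<epsilon> (z k) \<zeta>0" by (rule approx_subgradient_mono) (use k in simp)
    moreover have "dist (z k) (xb, s xb) < \<epsilon>" using z[of k] k(1) e0[of k] by simp
    ultimately show "\<exists>z. dist z (xb, s xb) < \<epsilon> \<and> approx_subgradient q \<epsilon> z \<zeta>0" by blast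
  qed
  moreover have "limiting_subgradient (\<lambda>x. snd \<zeta>0 \<bullet> s x) xb (v - fst \<zeta>0)"
    unfolding limiting_subgradient_def
  proof (intro allI impI)
    fix \<epsilon> :: real assume "\<epsilon> > 0"
    \<comment> \<open>Three errors share \<epsilon>: the tolerance \<open>3 * e k\<close>, the
      change of \<open>fst \<zeta>\<close>, and the change of \<open>snd \<zeta>\<close> multiplied
      by \<open>L\<close>. The denominator uses \<open>1 + L\<close> because \<open>L\<close> may be
      0.\<close>
    then have "\<epsilon> / (3 * (1 + L)) > 0" using L0 by simp
    then obtain k where k: "3 * e k < \<epsilon> / (3 * (1 + L))" "norm (\<zeta>0 - \<zeta> k) < \<epsilon> / (3 * (1 + L))"
      using approx by blast
    have "\<epsilon> / (3 * (1 + L)) * 1 \<le> \<epsilon> / (3 * (1 + L)) * (1 + L)"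
      using \<open>\<epsilon> / (3 * (1 + L)) > 0\<close> L0 by (intro mult_left_mono) auto
    also have "\<dots> = \<epsilon> / 3" using L0 by (simp add: field_simps)
    finally have third: "\<epsilon> / (3 * (1 + L)) \<le> \<epsilon> / 3" by simp
    have "norm (fst \<zeta>0 - fst (\<zeta> k)) \<le> norm (\<zeta>0 - \<zeta> k)"
      using norm_fst_le[of "fst (\<zeta>0 - \<zeta> k)" "snd (\<zeta>0 - \<zeta> k)"] unfolding prod.collapse
      by (simp only: fst_diff snd_diff)
    then have "norm (fst (\<zeta> k) - fst \<zeta>0) \<le> \<epsilon> / 3"
      using k(2) third norm_minus_commute[of "fst \<zeta>0" "fst (\<zeta> k)"] by linarith
    then have "norm ((v - fst \<zeta>0) - (v - fst (\<zeta> k))) \<le> \<epsilon> / 3" by simp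
    note sub = approx_subgradient_perturb[OF sub_s this]
    have "norm (snd \<zeta>0 - snd (\<zeta> k)) \<le> norm (\<zeta>0 - \<zeta> k)"
      using norm_snd_le[of "snd (\<zeta>0 - \<zeta> k)" "fst (\<zeta>0 - \<zeta> k)"] unfolding prod.collapse
      by (simp only: fst_diff snd_diff)
    then have "norm (snd \<zeta>0 - snd (\<zeta> k)) \<le> \<epsilon> / (3 * (1 + L))" using k(2) by simp
    then have "norm (snd \<zeta>0 - snd (\<zeta> k)) * L \<le> \<epsilon> / (3 * (1 + L)) * (1 + L)"
      using L0 \<open>\<epsilon> / (3 * (1 + L)) > 0\<close> by (intro mult_mono) auto
    also have "\<dots> = \<epsilon> / 3" using L0 by (simp add: field_simps)
    finally have small: "norm (snd \<zeta>0 - snd (\<zeta> k)) * L \<le> \<epsilon> / 3" .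
    have "\<forall>\<^sub>F x' in nhds (x k). \<bar>snd \<zeta>0 \<bullet> s x' - snd \<zeta>0 \<bullet> s (x k)
        - (snd (\<zeta> k) \<bullet> s x' - snd (\<zeta> k) \<bullet> s (x k)) - 0 \<bullet> (x' - x k)\<bar> \<le> \<epsilon> / 3 * norm (x' - x k)"
      using eventually_nhds_in_open[OF assms(1) xU]
    proof eventually_elim
      case (elim x')
      have "\<bar>(snd \<zeta>0 - snd (\<zeta> k)) \<bullet> (s x' - s (x k))\<bar> \<le> norm (snd \<zeta>0 - snd (\<zeta> k)) * norm (s x' - s (x k))"
        by (rule Cauchy_Schwarz_ineq2)
      also have "\<dots> \<le> norm (snd \<zeta>0 - snd (\<zeta> k)) * (L * norm (x' - x k))"
        using lipschitz_onD[OF assms(2) elim xU[of k]] by (intro mult_left_mono) (auto simp: dist_norm)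
      also have "\<dots> \<le> \<epsilon> / 3 * norm (x' - x k)"
        using mult_right_mono[OF small norm_ge_zero[of "x' - x k"]] by (simp add: mult.assoc)
      finally show ?case by (simp add: inner_diff_left inner_diff_right algebra_simps)
    qed
    from approx_subgradient_add[OF sub this]
    have "approx_subgradient (\<lambda>x. snd \<zeta>0 \<bullet> s x) \<epsilon> (x k) (v - fst \<zeta>0 + 0)"
      by (rule approx_subgradient_mono) (use k third in linarith)
    moreover have "dist (x k) xb < \<epsilon>" using x[of k] k(1) e0[of k] third \<open>\<epsilon> > 0\<close> by linarith
    ultimately show "\<exists>x. dist x xb < \<epsilon> \<and> approx_subgradient (\<lambda>x. snd \<zeta>0 \<bullet> s x) \<epsilon> x (v - fst \<zeta>0)"
      by auto
  qed
  ultimately show thesis using that by blast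
qed

section \<open>Normal cones of epigraphs and graphs\<close>

lemma frechet_normal_coneD:
  assumes "v \<in> frechet_normal_cone C zb" and "\<epsilon> > 0"
  shows "\<forall>\<^sub>F z in nhds zb. z \<in> C \<longrightarrow> v \<bullet> (z - zb) \<le> \<epsilon> * norm (z - zb)"
proof -
  have "\<forall>\<^sub>F z in at zb within C. v \<bullet> (z - zb) \<le> \<epsilon> * norm (z - zb)"
    using assms by (simp add: frechet_normal_cone_def)
  then have "\<forall>\<^sub>F z in nhds zb. z \<noteq> zb \<longrightarrow> z \<in> C \<longrightarrow> v \<bullet> (z - zb) \<le> \<epsilon> * norm (z - zb)"
    by (simp add: eventually_at_filter)
  then show ?thesis by eventually_elim auto
qed

text \<open>Velocities of paths inside \<open>C\<close> are tangent vectors, and Frechet normals are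
  polar to them. Letting \<gamma> depend on a vector parameter serves all directions
  \<open>d\<close> at once.\<close>

lemma frechet_normal_cone_tangent:
  assumes v: "v \<in> frechet_normal_cone C (\<gamma> x0)" and \<gamma>: "(\<gamma> has_derivative \<gamma>') (at x0)"
    and in_C: "\<And>x. \<gamma> x \<in> C"
  shows "v \<bullet> \<gamma>' d \<le> 0"
proof (cases "d = 0")
  case False
  have bl: "bounded_linear \<gamma>'" using \<gamma> by (rule has_derivative_bounded_linear)
  then obtain B where B: "B > 0" "\<And>x. norm (\<gamma>' x) \<le> norm x * B"
    using bounded_linear.pos_bounded by blast
  \<comment> \<open>\<open>B + 1\<close> bounds the growth of \<gamma> near \<open>x0\<close>, and
    \<open>norm v\<close> pays for its linearization error.\<close>
  define M where "M = B + 1 + norm v"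
  have "M > 0" using B(1) by (simp add: M_def add_pos_nonneg)
  have le: "v \<bullet> \<gamma>' d \<le> \<epsilon> * (M * norm d)" if "\<epsilon> > 0" "\<epsilon> \<le> 1" for \<epsilon>
  proof -
    have "(\<gamma> \<longlongrightarrow> \<gamma> x0) (nhds x0)"
      using has_derivative_continuous[OF \<gamma>] by (simp add: continuous_at tendsto_at_iff_tendsto_nhds)
    then have "\<forall>\<^sub>F x in nhds x0. \<gamma> x \<in> C \<longrightarrow> v \<bullet> (\<gamma> x - \<gamma> x0) \<le> \<epsilon> * norm (\<gamma> x - \<gamma> x0)"
      using frechet_normal_coneD[OF v \<open>\<epsilon> > 0\<close>] by (rule eventually_compose_filterlim[rotated])
    moreover have "\<forall>\<^sub>F x in nhds x0. norm (\<gamma> x - \<gamma> x0 - \<gamma>' (x - x0)) \<le> \<epsilon> * norm (x - x0)"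
      using \<gamma> \<open>\<epsilon> > 0\<close> unfolding has_derivative_at_alt eventually_nhds_metric dist_norm by blast
    ultimately have "\<forall>\<^sub>F x in nhds x0. v \<bullet> \<gamma>' (x - x0) \<le> \<epsilon> * M * norm (x - x0)"
    proof eventually_elim
      case (elim x)
      define r where "r = \<gamma> x - \<gamma> x0 - \<gamma>' (x - x0)"
      have r: "norm r \<le> \<epsilon> * norm (x - x0)" using elim by (simp add: r_def)
      have "v \<bullet> \<gamma>' (x - x0) = v \<bullet> (\<gamma> x - \<gamma> x0) - v \<bullet> r"
        by (simp add: r_def inner_diff_right)
      moreover have "- (v \<bullet> r) \<le> norm v * (\<epsilon> * norm (x - x0))"
        using norm_cauchy_schwarz[of "- v" r] mult_left_mono[OF r norm_ge_zero[of v]] by simp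
      moreover have "v \<bullet> (\<gamma> x - \<gamma> x0) \<le> \<epsilon> * norm (\<gamma> x - \<gamma> x0)" using elim in_C by blast
      moreover have "norm (\<gamma> x - \<gamma> x0) \<le> (B + 1) * norm (x - x0)"
      proof -
        have "norm (\<gamma> x - \<gamma> x0) \<le> norm r + norm (\<gamma>' (x - x0))"
          using norm_triangle_ineq[of r "\<gamma>' (x - x0)"] by (simp add: r_def)
        moreover have "\<epsilon> * norm (x - x0) \<le> 1 * norm (x - x0)"
          using \<open>\<epsilon> \<le> 1\<close> by (intro mult_right_mono) auto
        ultimately show ?thesis using r B(2)[of "x - x0"]
          unfolding distrib_right mult.commute[of B] by linarith
      qed
      then have "\<epsilon> * norm (\<gamma> x - \<gamma> x0) \<le> \<epsilon> * ((B + 1) * norm (x - x0))"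
        using \<open>\<epsilon> > 0\<close> by (intro mult_left_mono) auto
      ultimately show ?case by (simp add: M_def algebra_simps)
    qed
    then obtain \<delta> where \<delta>: "\<delta> > 0"
      "\<And>x. dist x x0 < \<delta> \<Longrightarrow> v \<bullet> \<gamma>' (x - x0) \<le> \<epsilon> * M * norm (x - x0)"
      unfolding eventually_nhds_metric by blast
    define t where "t = \<delta> / (2 * norm d)"
    have "t > 0" using \<delta>(1) False by (simp add: t_def)
    have "dist (x0 + t *\<^sub>R d) x0 < \<delta>"
      using \<delta>(1) False by (simp add: dist_norm t_def)
    from \<delta>(2)[OF this] have "t * (v \<bullet> \<gamma>' d) \<le> t * (\<epsilon> * (M * norm d))"
      using \<open>t > 0\<close> by (simp add: linear_cmul[OF bounded_linear.linear[OF bl]] ac_simps)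
    then show ?thesis using \<open>t > 0\<close> by simp
  qed
  show ?thesis
  proof (rule field_le_epsilon)
    fix e :: real assume "e > 0"
    define \<epsilon> where "\<epsilon> = min 1 (e / (M * norm d))"
    have pos: "M * norm d > 0" using \<open>M > 0\<close> False by simp
    have "\<epsilon> * (M * norm d) \<le> e / (M * norm d) * (M * norm d)"
      using pos by (intro mult_right_mono) (auto simp: \<epsilon>_def)
    also have "\<dots> = e" using \<open>M > 0\<close> False by simp
    finally show "v \<bullet> \<gamma>' d \<le> 0 + e"
      using le[of \<epsilon>] pos \<open>e > 0\<close> by (simp add: \<epsilon>_def)
  qed
next
  case True
  then show ?thesis using linear_0[OF has_derivative_linear[OF \<gamma>]] by simp
qed

text \<open>The approximating points may lie strictly above the graph, so differentiating \<phi> at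
  a graph point does not cover them. A vertical translate of the graph through such a point stays in
  the epigraph and is tangent there; it ties the two components of the normal together, and
  continuity of \<open>h\<close> passes this relation to the limit.\<close>

lemma mordukhovich_subdiff_C1:
  fixes \<phi> :: "'a::euclidean_space \<Rightarrow> real"
  assumes W: "open W" "xb \<in> W"
    and deriv: "\<And>x. x \<in> W \<Longrightarrow> (\<phi> has_derivative (\<lambda>d. h x \<bullet> d)) (at x)"
    and h: "continuous_on W h"
  shows "mordukhovich_subdiff \<phi> xb = {h xb}"
proof
  show "mordukhovich_subdiff \<phi> xb \<subseteq> {h xb}"
  proof
    fix \<xi> assume "\<xi> \<in> mordukhovich_subdiff \<phi> xb"
    then obtain vs zs where vs: "vs \<longlonglongrightarrow> (\<xi>, - 1)" and zs: "zs \<longlonglongrightarrow> (xb, \<phi> xb)"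
      and N: "\<And>k. zs k \<in> epigraph UNIV \<phi>" "\<And>k. vs k \<in> frechet_normal_cone (epigraph UNIV \<phi>) (zs k)"
      unfolding mordukhovich_subdiff_def normal_cone_def by blast
    have x_lim: "(\<lambda>k. fst (zs k)) \<longlonglongrightarrow> xb" using tendsto_fst[OF zs] by simp
    have eq: "fst (vs k) = - (snd (vs k) *\<^sub>R h (fst (zs k)))" if "fst (zs k) \<in> W" for k
    proof -
      define x where "x = fst (zs k)"
      \<comment> \<open>The height of the point above the graph; it is nonnegative, so the lifted
        graph \<gamma> remains in the epigraph.\<close>
      define a where "a = snd (zs k) - \<phi> x"
      define \<gamma> where "\<gamma> z = (z, \<phi> z + a)" for z
      have "\<gamma> x = zs k" by (simp add: \<gamma>_def x_def a_def)
      then have v: "vs k \<in> frechet_normal_cone (epigraph UNIV \<phi>) (\<gamma> x)" using N(2) by simp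
      have "x \<in> W" using that by (simp add: x_def)
      have "(\<gamma> has_derivative (\<lambda>d. (d, h x \<bullet> d))) (at x)"
        unfolding \<gamma>_def by (auto intro!: derivative_eq_intros deriv[OF \<open>x \<in> W\<close>])
      moreover have "\<gamma> z \<in> epigraph UNIV \<phi>" for z
        using N(1)[of k] by (auto simp: \<gamma>_def a_def x_def epigraph_def)
      ultimately have "vs k \<bullet> (d, h x \<bullet> d) \<le> 0" for d
        using frechet_normal_cone_tangent[of "vs k" _ \<gamma> x, OF v] by blast
      \<comment> \<open>The direction is the very vector to be shown zero, so the tangent inequality
        bounds its squared norm by 0.\<close>
      from this[of "fst (vs k) + snd (vs k) *\<^sub>R h x"]
      have "(fst (vs k) + snd (vs k) *\<^sub>R h x) \<bullet> (fst (vs k) + snd (vs k) *\<^sub>R h x) \<le> 0"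
        by (simp add: inner_prod_def algebra_simps)
      then have "fst (vs k) + snd (vs k) *\<^sub>R h x = 0"
        by (metis inner_ge_zero inner_eq_zero_iff order_antisym)
      then show ?thesis by (simp add: x_def eq_neg_iff_add_eq_0)
    qed
    have "\<forall>\<^sub>F k in sequentially. fst (zs k) \<in> W"
      using topological_tendstoD[OF x_lim W] .
    then have "\<forall>\<^sub>F k in sequentially. - (snd (vs k) *\<^sub>R h (fst (zs k))) = fst (vs k)"
      by eventually_elim (simp add: eq)
    moreover have "(\<lambda>k. - (snd (vs k) *\<^sub>R h (fst (zs k)))) \<longlonglongrightarrow> - (- 1 *\<^sub>R h xb)"
    proof -
      have "isCont h xb" using h W continuous_on_eq_continuous_at by blast
      then have "(\<lambda>k. h (fst (zs k))) \<longlonglongrightarrow> h xb" using x_lim by (rule isCont_tendsto_compose)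
      moreover have "(\<lambda>k. snd (vs k)) \<longlonglongrightarrow> - 1" using tendsto_snd[OF vs] by simp
      ultimately show ?thesis by (intro tendsto_intros)
    qed
    ultimately have "(\<lambda>k. fst (vs k)) \<longlonglongrightarrow> h xb" using Lim_transform_eventually by fastforce
    moreover have "(\<lambda>k. fst (vs k)) \<longlonglongrightarrow> \<xi>" using tendsto_fst[OF vs] by simp
    ultimately show "\<xi> \<in> {h xb}" using LIMSEQ_unique by blast
  qed
  have "approx_subgradient \<phi> \<epsilon> xb (h xb)" if "\<epsilon> > 0" for \<epsilon>
  proof -
    have "\<forall>\<^sub>F z in nhds xb. norm (\<phi> z - \<phi> xb - h xb \<bullet> (z - xb)) \<le> \<epsilon> * norm (z - xb)"
      using deriv[OF W(2)] that unfolding has_derivative_at_alt eventually_nhds_metric dist_norm by blast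
    then show ?thesis unfolding approx_subgradient_def
      by eventually_elim (simp add: abs_le_iff)
  qed
  then have "limiting_subgradient \<phi> xb (h xb)"
    unfolding limiting_subgradient_def by (metis dist_self)
  moreover have "continuous_on W \<phi>"
    by (rule has_derivative_continuous_on[OF has_derivative_at_withinI[OF deriv]])
  ultimately show "{h xb} \<subseteq> mordukhovich_subdiff \<phi> xb"
    using limiting_subgradient_imp_mordukhovich[OF W] by blast
qed

text \<open>Along the graph of a Lipschitz map the norm of an increment is at most
  \<open>1 + C\<close> times that of its first component. A Frechet normal to the graph thus becomes
  a subgradient inequality in \<open>x\<close> alone.\<close>

lemma coderivative_imp_limiting_subgradient:
  fixes h :: "'a::euclidean_space \<Rightarrow> 'b::euclidean_space"
  assumes W: "open W" "xb \<in> W" and \<Psi>: "\<And>x. x \<in> W \<Longrightarrow> \<Psi> x = {h x}"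
    and h: "C-lipschitz_on W h" and v: "v \<in> coderivative \<Psi> xb y w"
  shows "limiting_subgradient (\<lambda>x. w \<bullet> h x) xb v"
  unfolding limiting_subgradient_def
proof (intro allI impI)
  fix \<epsilon> :: real assume "\<epsilon> > 0"
  have C0: "C \<ge> 0" using h lipschitz_on_nonneg by blast
  \<comment> \<open>The budget: \<open>e * (1 + C)\<close> for the normal inequality,
    \<open>e\<close> for replacing the first component of the normal by \<open>v\<close>, and
    \<open>e * C\<close> for replacing the second by \<open>- w\<close>. The sum is
    \<epsilon>.\<close>
  define e where "e = \<epsilon> / (2 * (1 + C))"
  have "e > 0" using \<open>\<epsilon> > 0\<close> C0 by (simp add: e_def)
  have "2 * (1 + C) \<noteq> 0" using C0 by simp
  from nonzero_eq_divide_eq[OF this] e_def have e: "e * (2 * (1 + C)) = \<epsilon>" by blast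
  obtain vs zs where vs: "vs \<longlonglongrightarrow> (v, - w)" and zs: "zs \<longlonglongrightarrow> (xb, y)"
    and N: "\<And>k. zs k \<in> gph \<Psi>" "\<And>k. vs k \<in> frechet_normal_cone (gph \<Psi>) (zs k)"
    using v unfolding coderivative_def normal_cone_def by blast
  have x_lim: "(\<lambda>k. fst (zs k)) \<longlonglongrightarrow> xb" using tendsto_fst[OF zs] by simp
  have "\<forall>\<^sub>F k in sequentially. fst (zs k) \<in> W \<and> dist (fst (zs k)) xb < \<epsilon> \<and>
      dist (fst (vs k)) v < e \<and> dist (snd (vs k)) (- w) < e"
    using topological_tendstoD[OF x_lim W] tendstoD[OF x_lim \<open>\<epsilon> > 0\<close>]
      tendstoD[OF tendsto_fst[OF vs] \<open>e > 0\<close>] tendstoD[OF tendsto_snd[OF vs] \<open>e > 0\<close>]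
    by (simp add: eventually_conj_iff)
  then obtain k where k: "fst (zs k) \<in> W" "dist (fst (zs k)) xb < \<epsilon>"
    "norm (v - fst (vs k)) < e" "norm (- w - snd (vs k)) < e"
    unfolding eventually_sequentially dist_norm by (metis norm_minus_commute order_refl)
  define x where "x = fst (zs k)"
  have zk: "zs k = (x, h x)" using N(1)[of k] \<Psi>[OF k(1)] by (simp add: gph_def x_def prod_eq_iff split: prod.splits)
  have "isCont h x"
    using lipschitz_on_continuous_on[OF h] W k(1) continuous_on_eq_continuous_at by (metis x_def)
  then have "((\<lambda>x. (x, h x)) \<longlongrightarrow> (x, h x)) (nhds x)"
    by (intro tendsto_intros filterlim_ident) (simp add: continuous_at tendsto_at_iff_tendsto_nhds)
  from eventually_compose_filterlim[OF frechet_normal_coneD[OF N(2)[of k] \<open>e > 0\<close>, unfolded zk] this]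
  have "\<forall>\<^sub>F x' in nhds x. (x', h x') \<in> gph \<Psi> \<longrightarrow>
      vs k \<bullet> ((x', h x') - (x, h x)) \<le> e * norm ((x', h x') - (x, h x))" .
  moreover have "\<forall>\<^sub>F x' in nhds x. x' \<in> W" using eventually_nhds_in_open W k(1) by (simp add: x_def)
  ultimately have "approx_subgradient (\<lambda>x. w \<bullet> h x) \<epsilon> x v"
    unfolding approx_subgradient_def
  proof eventually_elim
    case (elim x')
    let ?n = "norm (x' - x)"
    have h_le: "norm (h x' - h x) \<le> C * ?n"
      using lipschitz_onD[OF h elim(2)] k(1) by (simp add: x_def dist_norm)
    have "norm ((x', h x') - (x, h x)) \<le> ?n + norm (h x' - h x)"
      using norm_Pair_le[of "x' - x" "h x' - h x"] by simp
    with h_le have "norm ((x', h x') - (x, h x)) \<le> (1 + C) * ?n" by (simp add: algebra_simps)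
    then have "e * norm ((x', h x') - (x, h x)) \<le> e * ((1 + C) * ?n)"
      using \<open>e > 0\<close> by (intro mult_left_mono) auto
    moreover have "(x', h x') \<in> gph \<Psi>" using \<Psi>[OF elim(2)] by (simp add: gph_def)
    ultimately have "fst (vs k) \<bullet> (x' - x) + snd (vs k) \<bullet> (h x' - h x) \<le> e * ((1 + C) * ?n)"
      using elim(1) by (simp add: inner_prod_def)
    moreover have "(v - fst (vs k)) \<bullet> (x' - x) \<le> e * ?n"
      using k(3) by (intro order_trans[OF norm_cauchy_schwarz] mult_right_mono) auto
    moreover have "(- w - snd (vs k)) \<bullet> (h x' - h x) \<le> e * (C * ?n)"
      using k(4) h_le \<open>e > 0\<close> by (intro order_trans[OF norm_cauchy_schwarz] mult_mono) auto
    ultimately have "v \<bullet> (x' - x) - (w \<bullet> h x' - w \<bullet> h x) \<le> e * ((1 + C) * ?n) + e * ?n + e * (C * ?n)"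
      by (simp add: inner_diff_left inner_diff_right)
    also have "\<dots> = e * (2 * (1 + C)) * ?n" by (simp add: algebra_simps)
    finally show ?case unfolding e by simp
  qed
  then show "\<exists>x. dist x xb < \<epsilon> \<and> approx_subgradient (\<lambda>x. w \<bullet> h x) \<epsilon> x v"
    using k(2) by (auto simp: x_def)
qed

section \<open>Strict differentiability and Lipschitz estimates\<close>

text \<open>The mean value inequality on a convex ball where \<open>h'\<close> stays within
  \<epsilon> of \<open>h' z0\<close>.\<close>

lemma has_derivative_strict:
  fixes h :: "'a::real_normed_vector \<Rightarrow> 'b::real_normed_vector" and h' :: "'a \<Rightarrow> 'a \<Rightarrow>\<^sub>L 'b"
  assumes deriv: "\<And>z. (h has_derivative h' z) (at z)" and cont: "isCont h' z0" and "\<epsilon> > 0"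
  shows "\<exists>\<delta>>0. \<forall>x\<in>ball z0 \<delta>. \<forall>y\<in>ball z0 \<delta>. norm (h y - h x - h' z0 (y - x)) \<le> \<epsilon> * norm (y - x)"
proof -
  obtain \<delta> where \<delta>: "\<delta> > 0" "\<And>z. dist z z0 < \<delta> \<Longrightarrow> dist (h' z) (h' z0) < \<epsilon>"
    using cont \<open>\<epsilon> > 0\<close> unfolding continuous_at_eps_delta by blast
  have "norm (h y - h x - h' z0 (y - x)) \<le> \<epsilon> * norm (y - x)"
    if "x \<in> ball z0 \<delta>" "y \<in> ball z0 \<delta>" for x y
  proof -
    have "x + t *\<^sub>R (y - x) \<in> ball z0 \<delta>" if "t \<in> {0..1}" for t
    proof -
      have "(1 - t) *\<^sub>R x + t *\<^sub>R y \<in> ball z0 \<delta>"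
        using that \<open>x \<in> ball z0 \<delta>\<close> \<open>y \<in> ball z0 \<delta>\<close> by (intro convexD[OF convex_ball]) auto
      then show ?thesis by (simp add: algebra_simps)
    qed
    moreover have "onorm (\<lambda>v. blinfun_apply (h' z) v - blinfun_apply (h' z0) v) \<le> \<epsilon>"
      if "z \<in> ball z0 \<delta>" for z
      using less_imp_le[OF \<delta>(2)[of z]] that
      by (simp add: dist_norm norm_blinfun.rep_eq blinfun.diff_left[abs_def] norm_minus_commute)
    moreover have "(h has_derivative h' z) (at z within ball z0 \<delta>)" for z
      using deriv by (rule has_derivative_at_withinI)
    moreover have "z0 \<in> ball z0 \<delta>" using \<delta>(1) by simp
    ultimately show ?thesis
      using differentiable_bound_linearization[of x y "ball z0 \<delta>" h "\<lambda>z. blinfun_apply (h' z)" z0 \<epsilon>]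
      by (simp add: mult.commute fun_diff_def)
  qed
  with \<delta>(1) show ?thesis by blast
qed

text \<open>A product rule in which \<open>l\<close> is only Lipschitz: its increment is kept as it
  is, with the coefficient frozen at \<open>z0\<close>. Every other term has a factor that becomes
  small near \<open>z0\<close>.\<close>

lemma strict_derivative_add_inner:
  fixes A :: "'a::real_normed_vector \<Rightarrow> real" and B l :: "'a \<Rightarrow> 'b::real_inner"
    and A' :: "'a \<Rightarrow> 'a \<Rightarrow>\<^sub>L real" and B' :: "'a \<Rightarrow> 'a \<Rightarrow>\<^sub>L 'b"
  assumes A: "\<And>z. (A has_derivative A' z) (at z)" "isCont A' z0"
    and B: "\<And>z. (B has_derivative B' z) (at z)" "isCont B' z0"
    and l: "open V" "z0 \<in> V" "K-lipschitz_on V l" and "\<epsilon> > 0"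
  shows "\<exists>\<delta>>0. \<forall>x\<in>ball z0 \<delta>. \<forall>z\<in>ball z0 \<delta>.
    \<bar>(A z + l z \<bullet> B z) - (A x + l x \<bullet> B x) - (A' z0 (z - x) + l z0 \<bullet> B' z0 (z - x)) - B z0 \<bullet> (l z - l x)\<bar>
      \<le> \<epsilon> * norm (z - x)"
proof -
  have K0: "K \<ge> 0" using l(3) lipschitz_on_nonneg by blast
  define b where "b = norm (B' z0) + 1"
  have "b > 0" by (simp add: b_def add_nonneg_pos)
  \<comment> \<open>Half of \<epsilon> covers the linearization errors of \<open>A\<close> and of
    \<open>l z0 \<bullet> B\<close>. Each of the two mixed products in \<open>R\<close> gets a
    quarter, which is what \<open>d4\<close> secures. The bound 1 makes \<open>b\<close> a Lipschitz
    constant of \<open>B\<close>.\<close>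
  define e where "e = min 1 (\<epsilon> / (2 * (1 + norm (l z0))))"
  have lp: "1 + norm (l z0) > 0" by (simp add: add_pos_nonneg)
  have "e > 0" "e \<le> 1" using \<open>\<epsilon> > 0\<close> lp by (auto simp: e_def)
  have "e \<le> \<epsilon> / (2 * (1 + norm (l z0)))" by (simp add: e_def)
  then have e_small: "e * (1 + norm (l z0)) \<le> \<epsilon> / 2" using lp by (simp add: field_simps)
  obtain d1 where d1: "d1 > 0" "\<And>x z. x \<in> ball z0 d1 \<Longrightarrow> z \<in> ball z0 d1 \<Longrightarrow>
      norm (A z - A x - A' z0 (z - x)) \<le> e * norm (z - x)"
    using has_derivative_strict[OF A \<open>e > 0\<close>] by blast
  obtain d2 where d2: "d2 > 0" "\<And>x z. x \<in> ball z0 d2 \<Longrightarrow> z \<in> ball z0 d2 \<Longrightarrow>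
      norm (B z - B x - B' z0 (z - x)) \<le> e * norm (z - x)"
    using has_derivative_strict[OF B \<open>e > 0\<close>] by blast
  obtain d3 where d3: "d3 > 0" "ball z0 d3 \<subseteq> V" using l(1,2) openE by blast
  define d4 where "d4 = \<epsilon> / (4 * (1 + K) * b)"
  have "d4 > 0" using \<open>\<epsilon> > 0\<close> K0 \<open>b > 0\<close> by (simp add: d4_def)
  have "4 * (1 + K) * b \<noteq> 0" using K0 \<open>b > 0\<close> by simp
  from nonzero_eq_divide_eq[OF this] d4_def have "d4 * (4 * (1 + K) * b) = \<epsilon>" by blast
  then have d4: "(1 + K) * b * d4 = \<epsilon> / 4" by (simp add: algebra_simps)
  define d where "d = min (min d1 d2) (min d3 d4)"
  have "d > 0" using d1 d2 d3 \<open>d4 > 0\<close> by (simp add: d_def)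
  moreover have "\<bar>(A z + l z \<bullet> B z) - (A x + l x \<bullet> B x) - (A' z0 (z - x) + l z0 \<bullet> B' z0 (z - x))
      - B z0 \<bullet> (l z - l x)\<bar> \<le> \<epsilon> * norm (z - x)" if x: "x \<in> ball z0 d" and z: "z \<in> ball z0 d" for x z
  proof -
    let ?n = "norm (z - x)"
    have xb: "x \<in> ball z0 d1" "x \<in> ball z0 d2" "x \<in> V" "norm (x - z0) \<le> d4"
      and zb: "z \<in> ball z0 d1" "z \<in> ball z0 d2" "z \<in> V" "norm (z - z0) \<le> d4"
      using x z d3 by (auto simp: d_def dist_norm norm_minus_commute)
    have B_lip: "norm (B w - B y) \<le> b * norm (w - y)" if "w \<in> ball z0 d2" "y \<in> ball z0 d2" for w y
    proof -
      have "norm (B w - B y) \<le> norm (B w - B y - B' z0 (w - y)) + norm (B' z0 (w - y))"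
        using norm_triangle_sub[of "B w - B y" "B' z0 (w - y)"] by simp
      also have "\<dots> \<le> 1 * norm (w - y) + norm (B' z0) * norm (w - y)"
        using d2(2)[OF that(2,1)] mult_right_mono[OF \<open>e \<le> 1\<close> norm_ge_zero[of "w - y"]]
          norm_blinfun[of "B' z0" "w - y"] by linarith
      finally show ?thesis by (simp add: b_def algebra_simps)
    qed
    have l_lip: "norm (l w - l y) \<le> (1 + K) * norm (w - y)" if "w \<in> V" "y \<in> V" for w y
      using lipschitz_onD[OF l(3) that] norm_ge_zero[of "w - y"]
      unfolding dist_norm distrib_right by linarith
    have z0b: "z0 \<in> ball z0 d2" using d2 by simp
    define R where "R = (A z - A x - A' z0 (z - x)) + l z0 \<bullet> (B z - B x - B' z0 (z - x))
      + (l z - l z0) \<bullet> (B z - B x) + (l z - l x) \<bullet> (B x - B z0)"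
    have "(A z + l z \<bullet> B z) - (A x + l x \<bullet> B x) - (A' z0 (z - x) + l z0 \<bullet> B' z0 (z - x))
      - B z0 \<bullet> (l z - l x) = R"
      by (simp add: R_def inner_diff_left inner_diff_right inner_commute)
    moreover have "\<bar>A z - A x - A' z0 (z - x)\<bar> \<le> e * ?n"
      using d1(2)[OF xb(1) zb(1)] by simp
    moreover have "\<bar>l z0 \<bullet> (B z - B x - B' z0 (z - x))\<bar> \<le> norm (l z0) * (e * ?n)"
      by (rule order_trans[OF Cauchy_Schwarz_ineq2]) (intro mult_left_mono d2(2) xb zb norm_ge_zero)
    moreover have "\<bar>(l z - l z0) \<bullet> (B z - B x)\<bar> \<le> \<epsilon> / 4 * ?n"
    proof -
      have "norm (l z - l z0) \<le> (1 + K) * d4"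
        using l_lip[OF zb(3) l(2)] mult_left_mono[OF zb(4), of "1 + K"] K0 by linarith
      then have "\<bar>(l z - l z0) \<bullet> (B z - B x)\<bar> \<le> ((1 + K) * d4) * (b * ?n)"
        using B_lip[OF zb(2) xb(2)] \<open>d4 > 0\<close> K0
        by (intro order_trans[OF Cauchy_Schwarz_ineq2] mult_mono) auto
      also have "\<dots> = \<epsilon> / 4 * ?n" unfolding d4[symmetric] by (simp only: ac_simps)
      finally show ?thesis .
    qed
    moreover have "\<bar>(l z - l x) \<bullet> (B x - B z0)\<bar> \<le> \<epsilon> / 4 * ?n"
    proof -
      have "norm (B x - B z0) \<le> b * d4"
        using B_lip[OF xb(2) z0b] mult_left_mono[OF xb(4), of b] \<open>b > 0\<close> by linarith
      then have "\<bar>(l z - l x) \<bullet> (B x - B z0)\<bar> \<le> ((1 + K) * ?n) * (b * d4)"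
        using l_lip[OF zb(3) xb(3)] K0
        by (intro order_trans[OF Cauchy_Schwarz_ineq2] mult_mono) auto
      also have "\<dots> = \<epsilon> / 4 * ?n" unfolding d4[symmetric] by (simp only: ac_simps)
      finally show ?thesis .
    qed
    moreover have "norm (l z0) * (e * ?n) + e * ?n \<le> \<epsilon> / 2 * ?n"
      using mult_right_mono[OF e_small, of ?n] by (simp add: algebra_simps)
    ultimately show ?thesis unfolding R_def by linarith
  qed
  ultimately show ?thesis by blast
qed

lemma lipschitz_near_componentwise:
  fixes h :: "'a::metric_space \<Rightarrow> 'b::euclidean_space"
  assumes "\<And>b. b \<in> Basis \<Longrightarrow> \<exists>\<delta>>0. \<exists>C. C-lipschitz_on (ball x \<delta>) (\<lambda>y. b \<bullet> h y)"
  shows "\<exists>\<delta>>0. \<exists>C. C-lipschitz_on (ball x \<delta>) h"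
proof -
  obtain \<delta> C where \<delta>: "\<And>b. b \<in> Basis \<Longrightarrow> \<delta> b > 0"
    and C: "\<And>b. b \<in> Basis \<Longrightarrow> (C b)-lipschitz_on (ball x (\<delta> b)) (\<lambda>y. b \<bullet> h y)"
    using assms by metis
  define d where "d = Min (\<delta> ` (Basis :: 'b set))"
  have "d > 0" using \<delta> by (simp add: d_def)
  moreover have "(\<Sum>b\<in>Basis. C b)-lipschitz_on (ball x d) h"
  proof (rule lipschitz_onI)
    fix y z assume yz: "y \<in> ball x d" "z \<in> ball x d"
    have "dist (h y) (h z) \<le> (\<Sum>b\<in>Basis. \<bar>(h y - h z) \<bullet> b\<bar>)"
      unfolding dist_norm by (rule norm_le_l1)
    also have "\<dots> \<le> (\<Sum>b\<in>Basis. C b * dist y z)"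
    proof (rule sum_mono)
      fix b :: 'b assume b: "b \<in> Basis"
      then have "d \<le> \<delta> b" by (simp add: d_def)
      with yz have "y \<in> ball x (\<delta> b)" "z \<in> ball x (\<delta> b)" by auto
      from lipschitz_onD[OF C[OF b] this] show "\<bar>(h y - h z) \<bullet> b\<bar> \<le> C b * dist y z"
        by (simp add: dist_real_def inner_diff_left inner_diff_right inner_commute)
    qed
    finally show "dist (h y) (h z) \<le> (\<Sum>b\<in>Basis. C b) * dist y z" by (simp add: sum_distrib_right)
  next
    show "0 \<le> (\<Sum>b\<in>Basis. C b)" using C lipschitz_on_nonneg by (intro sum_nonneg) blast
  qed
  ultimately show ?thesis by blast
qed

lemma lipschitz_on_graph:
  assumes "L-lipschitz_on U s"
  shows "(1 + L)-lipschitz_on U (\<lambda>x. (x, s x))"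
proof (rule lipschitz_onI)
  fix x y assume "x \<in> U" "y \<in> U"
  have "dist (x, s x) (y, s y) \<le> dist x y + dist (s x) (s y)"
    unfolding dist_Pair_Pair by (rule sqrt_sum_squares_le_sum) simp_all
  also have "\<dots> \<le> (1 + L) * dist x y"
    using lipschitz_onD[OF assms \<open>x \<in> U\<close> \<open>y \<in> U\<close>] by (simp add: algebra_simps)
  finally show "dist (x, s x) (y, s y) \<le> (1 + L) * dist x y" .
qed (use lipschitz_on_nonneg[OF assms] in simp)

lemma lipschitz_on_inner_const:
  fixes h :: "'a::metric_space \<Rightarrow> 'b::real_inner"
  assumes "C-lipschitz_on U h"
  shows "(norm w * C)-lipschitz_on U (\<lambda>x. w \<bullet> h x)"
proof (rule lipschitz_onI)
  fix x y assume "x \<in> U" "y \<in> U"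
  have "\<bar>w \<bullet> (h x - h y)\<bar> \<le> norm w * norm (h x - h y)" by (rule Cauchy_Schwarz_ineq2)
  also have "\<dots> \<le> norm w * (C * dist x y)"
    using lipschitz_onD[OF assms \<open>x \<in> U\<close> \<open>y \<in> U\<close>] by (intro mult_left_mono) (auto simp: dist_norm)
  finally show "dist (w \<bullet> h x) (w \<bullet> h y) \<le> norm w * C * dist x y"
    by (simp add: dist_real_def inner_diff_right)
qed (use lipschitz_on_nonneg[OF assms] in simp)

section \<open>Lagrange multipliers\<close>

text \<open>Its norm is the Euclidean distance of \<open>v\<close> from the nonpositive orthant,
  that is, the violation of the constraint \<open>v \<le> 0\<close>.\<close>

definition pos_part_vec :: "real ^ 'p \<Rightarrow> real ^ 'p" where
  "pos_part_vec v = (\<chi> i. max 0 (v $ i))"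

lemma pos_part_vec_nonneg: "0 \<le> pos_part_vec v"
  by (simp add: pos_part_vec_def less_eq_vec_def)

lemma pos_part_vec_eq_0_iff: "pos_part_vec v = 0 \<longleftrightarrow> v \<le> 0"
proof -
  have "max 0 t = 0 \<longleftrightarrow> t \<le> 0" for t :: real by (simp add: max_def)
  then show ?thesis by (simp add: pos_part_vec_def less_eq_vec_def vec_eq_iff)
qed

lemma continuous_on_pos_part_vec [continuous_intros]:
  "continuous_on S h \<Longrightarrow> continuous_on S (\<lambda>x. pos_part_vec (h x))"
  unfolding pos_part_vec_def by (intro continuous_intros)

text \<open>A smooth quadratic model that dominates the penalty and agrees with it at
  \<open>v\<close>. A minimizer of a penalized function then also minimizes the smooth majorant, and
  the maximum need not be differentiated.\<close>

lemma norm_pos_part_vec_square_le: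
  "(norm (pos_part_vec w))\<^sup>2 \<le>
     (norm (pos_part_vec v))\<^sup>2 + 2 * (pos_part_vec v \<bullet> (w - v)) + (norm (w - v))\<^sup>2"
proof -
  have "norm (pos_part_vec w) \<le> norm ((w - v) + pos_part_vec v)"
    by (rule norm_le_componentwise_cart) (auto simp: pos_part_vec_def max_def)
  then have "(norm (pos_part_vec w))\<^sup>2 \<le> (norm ((w - v) + pos_part_vec v))\<^sup>2"
    by (rule power_mono) simp
  also have "\<dots> = (norm (pos_part_vec v))\<^sup>2 + 2 * (pos_part_vec v \<bullet> (w - v)) + (norm (w - v))\<^sup>2"
    by (simp only: power2_norm_eq_inner inner_add_left inner_add_right inner_commute)
  finally show ?thesis .
qed

text \<open>Minimizers of the quadratic penalty approximations converge to \<open>y0\<close>; the multipliers come from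
  the normalized derivatives of the penalty.\<close>

lemma fritz_john:
  fixes F :: "'a::euclidean_space \<Rightarrow> real" and G :: "'a \<Rightarrow> real ^ 'p"
    and F' :: "'a \<Rightarrow> 'a \<Rightarrow>\<^sub>L real" and G' :: "'a \<Rightarrow> 'a \<Rightarrow>\<^sub>L (real ^ 'p)"
  assumes F: "\<And>y. (F has_derivative F' y) (at y)" and G: "\<And>y. (G has_derivative G' y) (at y)"
    and cont: "isCont F' y0" "isCont G' y0"
    and feas: "G y0 \<le> 0" and opt: "\<And>y. G y \<le> 0 \<Longrightarrow> F y0 \<le> F y"
  obtains \<tau> u where "\<tau> \<ge> 0" "0 \<le> u" "(\<tau>, u) \<noteq> 0" "u \<bullet> G y0 = 0"
    "\<And>d. \<tau> * F' y0 d + u \<bullet> G' y0 d = 0"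
proof -
  have Fc: "continuous_on S F" and Gc: "continuous_on S G" for S
    by (rule has_derivative_continuous_on[OF has_derivative_at_withinI[OF F]])
      (rule has_derivative_continuous_on[OF has_derivative_at_withinI[OF G]])
  define K where "K = cball y0 1"
  have "compact K" "y0 \<in> K" by (auto simp: K_def)
  \<comment> \<open>The quadratic term singles out \<open>y0\<close> among possibly many minimizers,
    so cluster points of penalized minimizers equal \<open>y0\<close>; its gradient vanishes at
    \<open>y0\<close> and leaves no trace in the limit.\<close>
  define P where "P k y = F y + (norm (y - y0))\<^sup>2 + real k * (norm (pos_part_vec (G y)))\<^sup>2" for k y
  have P_cont: "continuous_on S (P k)" for S k
    unfolding P_def by (intro continuous_intros Fc Gc)
  have "\<exists>y\<in>K. \<forall>z\<in>K. P k y \<le> P k z" for k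
    using continuous_attains_inf[OF \<open>compact K\<close> _ P_cont] \<open>y0 \<in> K\<close> by blast
  then obtain y where yK: "\<And>k. y k \<in> K" and y_min: "\<And>k z. z \<in> K \<Longrightarrow> P k (y k) \<le> P k z"
    by metis
  obtain m where m: "\<And>z. z \<in> K \<Longrightarrow> F m \<le> F z"
    using continuous_attains_inf[OF \<open>compact K\<close> _ Fc] \<open>y0 \<in> K\<close> by blast
  have Py: "F (y k) + (norm (y k - y0))\<^sup>2 + real k * (norm (pos_part_vec (G (y k))))\<^sup>2 \<le> F y0" for k
  proof -
    have "pos_part_vec (G y0) = 0" using feas by (simp add: pos_part_vec_eq_0_iff)
    then show ?thesis using y_min[OF \<open>y0 \<in> K\<close>, of k] by (simp add: P_def)
  qed
  define u where "u k = (2 * real k) *\<^sub>R pos_part_vec (G (y k))" for k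
  \<comment> \<open>\<open>u k\<close> may be unbounded. Normalizing it together with the
    coefficient 1 of the objective gives a convergent subsequence whose limit has norm 1 and hence
    is nonzero.\<close>
  define w where "w k = (1 / norm (1::real, u k)) *\<^sub>R (1::real, u k)" for k
  have nz: "norm (1::real, u k) > 0" for k by (simp add: prod_eq_iff)
  have "norm (w k) = 1" for k unfolding w_def norm_scaleR using nz[of k] by simp
  then have w_sphere: "w k \<in> sphere 0 1" for k by simp
  have "seq_compact (K \<times> sphere (0 :: real \<times> (real ^ 'p)) 1)"
    using \<open>compact K\<close> by (intro compact_imp_seq_compact compact_Times compact_sphere)
  moreover have "\<forall>k. (y k, w k) \<in> K \<times> sphere 0 1" using yK w_sphere by blast
  ultimately obtain p r where "p \<in> K \<times> sphere (0 :: real \<times> (real ^ 'p)) 1" and r: "strict_mono r"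
    and conv: "((\<lambda>k. (y k, w k)) \<circ> r) \<longlonglongrightarrow> p"
    by (rule seq_compactE)
  then obtain y1 \<tau> v where p: "p = (y1, (\<tau>, v))" "norm (\<tau>, v) = 1"
    by (cases p) auto
  have y_lim: "(\<lambda>k. y (r k)) \<longlonglongrightarrow> y1" and w_lim: "(\<lambda>k. w (r k)) \<longlonglongrightarrow> (\<tau>, v)"
    using tendsto_fst[OF conv] tendsto_snd[OF conv] by (simp_all add: p o_def)
  have F_lim: "(\<lambda>k. F (y (r k))) \<longlonglongrightarrow> F y1" and G_lim: "(\<lambda>k. G (y (r k))) \<longlonglongrightarrow> G y1"
    using continuous_on_tendsto_compose[OF Fc[of UNIV] y_lim] continuous_on_tendsto_compose[OF Gc[of UNIV] y_lim]
    by simp_all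
  have r_lim: "filterlim (\<lambda>k. real (r k)) at_top sequentially"
    using filterlim_compose[OF filterlim_real_sequentially filterlim_subseq[OF r]] .
  have "G y1 \<le> 0"
  proof -
    have "(\<lambda>k. (norm (pos_part_vec (G (y (r k)))))\<^sup>2) \<longlonglongrightarrow> (norm (pos_part_vec (G y1)))\<^sup>2"
      using continuous_on_tendsto_compose[OF continuous_on_pos_part_vec[OF continuous_on_id, of UNIV] G_lim]
      by (intro tendsto_intros) simp
    moreover have "(\<lambda>k. (norm (pos_part_vec (G (y (r k)))))\<^sup>2) \<longlonglongrightarrow> 0"
    proof (rule tendsto_sandwich[OF _ _ tendsto_const])
      show "(\<lambda>k. (F y0 - F m) / real (r k)) \<longlonglongrightarrow> 0"
        using r_lim by (intro tendsto_divide_0[OF tendsto_const] filterlim_at_top_imp_at_infinity)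
      have "\<forall>\<^sub>F k in sequentially. real (r k) > 0"
        using r_lim by (rule filterlim_at_top_dense[THEN iffD1, rule_format])
      then show "\<forall>\<^sub>F k in sequentially. (norm (pos_part_vec (G (y (r k)))))\<^sup>2 \<le> (F y0 - F m) / real (r k)"
      proof eventually_elim
        case (elim k)
        have "real (r k) * (norm (pos_part_vec (G (y (r k)))))\<^sup>2 \<le> F y0 - F m"
          using Py[of "r k"] m[OF yK[of "r k"]] zero_le_power2[of "norm (y (r k) - y0)"] by linarith
        then show ?case using elim by (simp add: field_simps)
      qed
    qed simp
    ultimately have "(norm (pos_part_vec (G y1)))\<^sup>2 = 0" by (rule LIMSEQ_unique)
    then show ?thesis by (simp add: pos_part_vec_eq_0_iff)
  qed
  have "F y1 + (norm (y1 - y0))\<^sup>2 \<le> F y0"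
  proof (rule tendsto_upperbound)
    show "(\<lambda>k. F (y (r k)) + (norm (y (r k) - y0))\<^sup>2) \<longlonglongrightarrow> F y1 + (norm (y1 - y0))\<^sup>2"
      by (intro tendsto_intros F_lim y_lim)
    have "F (y k) + (norm (y k - y0))\<^sup>2 \<le> F y0" for k
      using Py[of k] mult_nonneg_nonneg[OF of_nat_0_le_iff zero_le_power2, of k "norm (pos_part_vec (G (y k)))"]
      by linarith
    then show "\<forall>\<^sub>F k in sequentially. F (y (r k)) + (norm (y (r k) - y0))\<^sup>2 \<le> F y0" by simp
  qed simp
  with opt[OF \<open>G y1 \<le> 0\<close>] have "(norm (y1 - y0))\<^sup>2 \<le> 0" by linarith
  then have [simp]: "y1 = y0" by simp
  have stationary: "F' (y k) d + 2 * ((y k - y0) \<bullet> d) + u k \<bullet> G' (y k) d = 0"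
    if "dist (y k) y0 < 1" for k d
  proof -
    \<comment> \<open>The increment of \<open>P k\<close> with the penalty replaced by its quadratic
      majorant. It vanishes at \<open>y k\<close>, is nonnegative on the ball, and its last term has
      derivative 0 at \<open>y k\<close>.\<close>
    define R where "R z = F z - F (y k) + ((z - y0) \<bullet> (z - y0) - (y k - y0) \<bullet> (y k - y0))
      + u k \<bullet> (G z - G (y k)) + real k * ((G z - G (y k)) \<bullet> (G z - G (y k)))" for z
    have "(R has_derivative (\<lambda>d. F' (y k) d + 2 * ((y k - y0) \<bullet> d) + u k \<bullet> G' (y k) d)) (at (y k))"
      unfolding R_def
      by (rule derivative_eq_intros F G refl | simp)+ (simp add: algebra_simps inner_commute)
    moreover have "\<forall>z\<in>ball y0 1. R (y k) \<le> R z"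
    proof
      fix z assume "z \<in> ball y0 1"
      then have "P k (y k) \<le> P k z" using y_min by (simp add: K_def)
      moreover have "real k * (norm (pos_part_vec (G z)))\<^sup>2 \<le> real k * ((norm (pos_part_vec (G (y k))))\<^sup>2
          + 2 * (pos_part_vec (G (y k)) \<bullet> (G z - G (y k))) + (norm (G z - G (y k)))\<^sup>2)"
        by (intro mult_left_mono norm_pos_part_vec_square_le) simp
      ultimately show "R (y k) \<le> R z"
        by (simp add: R_def P_def u_def power2_norm_eq_inner algebra_simps)
    qed
    moreover have "y k \<in> ball y0 1" using that by (simp add: dist_commute)
    ultimately have "(\<lambda>d. F' (y k) d + 2 * ((y k - y0) \<bullet> d) + u k \<bullet> G' (y k) d) = (\<lambda>d. 0)"
      by (intro differential_zero_maxmin[OF _ open_ball]) auto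
    then show ?thesis by meson
  qed
  have \<tau>_lim: "(\<lambda>k. fst (w (r k))) \<longlonglongrightarrow> \<tau>" and v_lim: "(\<lambda>k. snd (w (r k))) \<longlonglongrightarrow> v"
    using tendsto_fst[OF w_lim] tendsto_snd[OF w_lim] by simp_all
  have w_nonneg: "0 \<le> fst (w k)" "0 \<le> snd (w k)" for k
    using nz[of k] pos_part_vec_nonneg[of "G (y k)"]
    by (auto simp: w_def u_def less_eq_vec_def intro!: mult_nonneg_nonneg)
  have \<tau>0: "\<tau> \<ge> 0" using \<tau>_lim w_nonneg(1) by (intro tendsto_lowerbound[OF \<tau>_lim]) auto
  have v_i: "(\<lambda>k. snd (w (r k)) $ i) \<longlonglongrightarrow> v $ i" for i by (intro tendsto_intros v_lim)
  have v0: "0 \<le> v"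
    unfolding less_eq_vec_def zero_index
  proof
    fix i
    show "0 \<le> v $ i"
      using w_nonneg(2) by (intro tendsto_lowerbound[OF v_i]) (auto simp: less_eq_vec_def)
  qed
  have "(\<tau>, v) \<noteq> 0" using p(2) by auto
  moreover have "v \<bullet> G y0 = 0"
  proof -
    have "v $ i * G y0 $ i = 0" for i
    proof (cases "G y0 $ i < 0")
      case True
      have "(\<lambda>k. G (y (r k)) $ i) \<longlonglongrightarrow> G y0 $ i" using G_lim by (intro tendsto_intros) simp
      then have "\<forall>\<^sub>F k in sequentially. G (y (r k)) $ i < 0" using True by (rule order_tendstoD)
      then have "\<forall>\<^sub>F k in sequentially. snd (w (r k)) $ i = 0"
        by eventually_elim (simp add: w_def u_def pos_part_vec_def)
      then have "(\<lambda>k. snd (w (r k)) $ i) \<longlonglongrightarrow> 0" by (rule tendsto_eventually)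
      with v_i have "v $ i = 0" by (rule LIMSEQ_unique)
      then show ?thesis by simp
    next
      case False
      with feas have "G y0 $ i = 0" by (simp add: less_eq_vec_def antisym_conv2)
      then show ?thesis by simp
    qed
    then show ?thesis unfolding inner_vec_def inner_real_def by (intro sum.neutral) blast
  qed
  moreover have "\<tau> * F' y0 d + v \<bullet> G' y0 d = 0" for d
  proof -
    have F'_lim: "(\<lambda>k. F' (y (r k))) \<longlonglongrightarrow> F' y0" and G'_lim: "(\<lambda>k. G' (y (r k))) \<longlonglongrightarrow> G' y0"
      using isCont_tendsto_compose[OF cont(1)] isCont_tendsto_compose[OF cont(2)] y_lim by simp_all
    have lim: "(\<lambda>k. fst (w (r k)) * F' (y (r k)) d + 2 * fst (w (r k)) * ((y (r k) - y0) \<bullet> d)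
        + snd (w (r k)) \<bullet> G' (y (r k)) d) \<longlonglongrightarrow> \<tau> * F' y0 d + 2 * \<tau> * ((y0 - y0) \<bullet> d) + v \<bullet> G' y0 d"
      using y_lim by (intro tendsto_intros \<tau>_lim v_lim F'_lim G'_lim) simp
    have "\<forall>\<^sub>F k in sequentially. dist (y (r k)) y0 < 1" using tendstoD[OF y_lim, of 1] by simp
    then have "\<forall>\<^sub>F k in sequentially. fst (w (r k)) * F' (y (r k)) d
        + 2 * fst (w (r k)) * ((y (r k) - y0) \<bullet> d) + snd (w (r k)) \<bullet> G' (y (r k)) d = 0"
    proof eventually_elim
      case (elim k)
      define c where "c = 1 / norm (1::real, u (r k))"
      have w: "fst (w (r k)) = c" "snd (w (r k)) = c *\<^sub>R u (r k)" by (simp_all add: w_def c_def)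
      have "fst (w (r k)) * F' (y (r k)) d + 2 * fst (w (r k)) * ((y (r k) - y0) \<bullet> d)
        + snd (w (r k)) \<bullet> G' (y (r k)) d =
        c * (F' (y (r k)) d + 2 * ((y (r k) - y0) \<bullet> d) + u (r k) \<bullet> G' (y (r k)) d)"
        unfolding w by (simp add: algebra_simps)
      then show ?case unfolding stationary[OF elim] by simp
    qed
    from LIMSEQ_unique[OF lim tendsto_eventually[OF this]] show ?thesis by simp
  qed
  ultimately show thesis using that \<tau>0 v0 by blast
qed

text \<open>If \<open>\<tau>\<close> were 0, the constraint qualification would force
  \<open>u = 0\<close> as well, contradicting nontriviality; so one may divide by
  \<open>\<tau>\<close>.\<close>

lemma kkt_multiplier_exists:
  fixes F :: "'a::euclidean_space \<Rightarrow> real" and G :: "'a \<Rightarrow> real ^ 'p"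
    and F' :: "'a \<Rightarrow> 'a \<Rightarrow>\<^sub>L real" and G' :: "'a \<Rightarrow> 'a \<Rightarrow>\<^sub>L (real ^ 'p)"
  assumes "\<And>y. (F has_derivative F' y) (at y)" "\<And>y. (G has_derivative G' y) (at y)"
    and "isCont F' y0" "isCont G' y0"
    and "G y0 \<le> 0" and "\<And>y. G y \<le> 0 \<Longrightarrow> F y0 \<le> F y"
    and mfcq: "\<And>u. 0 \<le> u \<Longrightarrow> u \<bullet> G y0 = 0 \<Longrightarrow> (\<And>d. u \<bullet> G' y0 d = 0) \<Longrightarrow> u = 0"
  obtains u where "0 \<le> u" "u \<bullet> G y0 = 0" "\<And>d. F' y0 d + u \<bullet> G' y0 d = 0"
proof -
  obtain \<tau> u where \<tau>: "\<tau> \<ge> 0" "0 \<le> u" "(\<tau>, u) \<noteq> 0" "u \<bullet> G y0 = 0"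
    "\<And>d. \<tau> * F' y0 d + u \<bullet> G' y0 d = 0"
    using fritz_john[OF assms(1-6)] by blast
  have "\<tau> \<noteq> 0" using mfcq[of u] \<tau> by (auto simp: zero_prod_def)
  with \<tau>(1) have "\<tau> > 0" by simp
  show thesis
  proof (rule that[of "(1 / \<tau>) *\<^sub>R u"])
    show "0 \<le> (1 / \<tau>) *\<^sub>R u" using \<tau>(2) \<open>\<tau> > 0\<close> by (simp add: less_eq_vec_def)
    show "((1 / \<tau>) *\<^sub>R u) \<bullet> G y0 = 0" using \<tau>(4) by simp
    show "F' y0 d + ((1 / \<tau>) *\<^sub>R u) \<bullet> G' y0 d = 0" for d
      using \<tau>(5)[of d] \<open>\<tau> > 0\<close> by (simp add: field_simps)
  qed
qed

text \<open>Violations scale to unit vectors \<open>u\<close>. Complementarity written as an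
  equation is a closed condition although the set of active indices jumps with \<open>z\<close>, so
  the violating pairs form a closed set, and compactness of the sphere makes its projection near
  \<open>z0\<close> closed too.\<close>

lemma positive_linear_independence_open:
  fixes G :: "'a::euclidean_space \<Rightarrow> real ^ 'p" and G' :: "'a \<Rightarrow> 'b::real_normed_vector \<Rightarrow>\<^sub>L (real ^ 'p)"
  assumes "continuous_on UNIV G" "continuous_on UNIV G'"
    and z0: "\<And>u. 0 \<le> u \<Longrightarrow> u \<bullet> G z0 = 0 \<Longrightarrow> (\<And>d. u \<bullet> G' z0 d = 0) \<Longrightarrow> u = 0"
  shows "\<forall>\<^sub>F z in nhds z0. \<forall>u. 0 \<le> u \<and> u \<bullet> G z = 0 \<and> (\<forall>d. u \<bullet> G' z d = 0) \<longrightarrow> u = 0"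
proof -
  define M where "M = {p :: 'a \<times> (real ^ 'p). (\<forall>i. 0 \<le> snd p $ i) \<and> snd p \<bullet> G (fst p) = 0 \<and> (\<forall>d. snd p \<bullet> G' (fst p) d = 0)}"
  have "closed M"
    unfolding M_def
    by (intro closed_Collect_conj closed_Collect_all closed_Collect_le closed_Collect_eq
        continuous_intros continuous_on_compose2[OF assms(1)] continuous_on_compose2[OF assms(2)]) auto
  then have "compact (M \<inter> (cball z0 1 \<times> sphere 0 1))"
    by (intro closed_Int_compact compact_Times compact_cball compact_sphere)
  then have "closed (fst ` (M \<inter> (cball z0 1 \<times> sphere 0 1)))"
    by (intro compact_imp_closed compact_continuous_image continuous_intros)
  moreover have "z0 \<notin> fst ` (M \<inter> (cball z0 1 \<times> sphere 0 1))"
  proof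
    assume "z0 \<in> fst ` (M \<inter> (cball z0 1 \<times> sphere 0 1))"
    then obtain u where "(z0, u) \<in> M" "norm u = 1" by auto
    then show False using z0[of u] by (auto simp: M_def less_eq_vec_def)
  qed
  ultimately have "\<forall>\<^sub>F z in nhds z0. z \<in> - fst ` (M \<inter> (cball z0 1 \<times> sphere 0 1))"
    by (intro eventually_nhds_in_open) auto
  moreover have "\<forall>\<^sub>F z in nhds z0. z \<in> ball z0 1" by (intro eventually_nhds_in_open) auto
  ultimately show ?thesis
  proof eventually_elim
    case (elim z)
    have "u = 0" if u: "0 \<le> u" "u \<bullet> G z = 0" "\<forall>d. u \<bullet> G' z d = 0" for u
    proof (rule ccontr)
      assume "u \<noteq> 0"
      define u1 where "u1 = (1 / norm u) *\<^sub>R u"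
      have "(z, u1) \<in> M" using u by (simp add: M_def u1_def less_eq_vec_def)
      moreover have "norm u1 = 1" using \<open>u \<noteq> 0\<close> by (simp add: u1_def)
      ultimately have "(z, u1) \<in> M \<inter> (cball z0 1 \<times> sphere 0 1)" using elim(2) by simp
      then have "z \<in> fst ` (M \<inter> (cball z0 1 \<times> sphere 0 1))" by force
      with elim(1) show False by blast
    qed
    then show ?case by blast
  qed
qed

section \<open>The value function and the Lagrangian\<close>

lemma inner_vec_nonpos:
  fixes u v :: "real ^ 'p"
  assumes "0 \<le> u" "v \<le> 0" shows "u \<bullet> v \<le> 0"
  unfolding inner_vec_def inner_real_def
  by (rule sum_nonpos) (use assms in \<open>auto simp: less_eq_vec_def mult_nonneg_nonpos\<close>)

text \<open>With \<open>u x \<ge> 0\<close>, \<open>g \<le> 0\<close> and complementarity, \<open>\<phi> x - \<phi> x0\<close> lies between the increments of the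
  Lagrangian taken with the multipliers \<open>u x0\<close> and \<open>u x\<close>, whose derivatives in \<open>y\<close> vanish in the limit.\<close>

lemma value_has_derivative:
  fixes f :: "'a::real_normed_vector \<times> 'b::real_normed_vector \<Rightarrow> real" and g :: "'a \<times> 'b \<Rightarrow> real ^ 'p"
  assumes f: "(f has_derivative f') (at (x0, s x0))" and g: "(g has_derivative g') (at (x0, s x0))"
    and W: "open W" "x0 \<in> W" and s: "L-lipschitz_on W s"
    and u: "\<And>x. x \<in> W \<Longrightarrow> 0 \<le> u x \<and> g (x, s x) \<le> 0 \<and> u x \<bullet> g (x, s x) = 0" "isCont u x0"
    and stat: "\<And>d. f' (0, d) + u x0 \<bullet> g' (0, d) = 0"
    and \<phi>: "\<And>x. x \<in> W \<Longrightarrow> \<phi> x = f (x, s x)"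
  shows "(\<phi> has_derivative (\<lambda>d. f' (d, 0) + u x0 \<bullet> g' (d, 0))) (at x0)"
proof -
  have L0: "L \<ge> 0" using s lipschitz_on_nonneg by blast
  have f'l: "bounded_linear f'" and g'l: "bounded_linear g'"
    using f g has_derivative_bounded_linear by blast+
  obtain B where B: "B > 0" "\<And>z. norm (g' z) \<le> norm z * B"
    using bounded_linear.pos_bounded[OF g'l] by blast
  define Z where "Z x = (x, s x)" for x
  define D where "D d = f' (d, 0) + u x0 \<bullet> g' (d, 0)" for d
  \<comment> \<open>Stationarity in the second variable makes the linearized Lagrangian depend on
    the increment of \<open>x\<close> alone. This removes the increment of \<open>s\<close>, which
    need not be differentiable.\<close>
  have D_eq: "f' z + u x0 \<bullet> g' z = D (fst z)" for z
  proof -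
    have "f' z = f' (fst z, 0) + f' (0, snd z)" "g' z = g' (fst z, 0) + g' (0, snd z)"
      using linear_add[OF bounded_linear.linear[OF f'l], of "(fst z, 0)" "(0, snd z)"]
        linear_add[OF bounded_linear.linear[OF g'l], of "(fst z, 0)" "(0, snd z)"] by simp_all
    then show ?thesis using stat[of "snd z"] by (simp add: D_def inner_add_right)
  qed
  have "bounded_linear D" unfolding D_def
    by (intro bounded_linear_add bounded_linear_compose[OF f'l] bounded_linear_compose[OF bounded_linear_inner_right]
      bounded_linear_compose[OF g'l] bounded_linear_Pair bounded_linear_ident bounded_linear_zero)
  moreover have "\<forall>\<^sub>F x in at x0. norm (\<phi> x - \<phi> x0 - D (x - x0)) \<le> \<epsilon> * norm (x - x0)" if "\<epsilon> > 0" for \<epsilon>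
  proof -
    \<comment> \<open>\<open>1 + L\<close> passes from increments of \<open>(x, s x)\<close> to
      those of \<open>x\<close>. The second factor adds up the errors: 1 for \<open>f\<close>,
      \<open>norm (u x0)\<close> and \<open>norm (u x0) + 1\<close> for \<open>g\<close> in the
      lower and upper bound, and \<open>B\<close> for the change of multiplier.\<close>
    define M where "M = (1 + L) * (2 + 2 * norm (u x0) + B)"
    have "M > 0" using L0 B(1) by (simp add: M_def add_pos_nonneg add_nonneg_pos)
    define e where "e = min 1 (\<epsilon> / M)"
    have "e > 0" "e \<le> 1" using \<open>\<epsilon> > 0\<close> \<open>M > 0\<close> by (auto simp: e_def)
    have "e * M \<le> \<epsilon> / M * M" using \<open>M > 0\<close> by (intro mult_right_mono) (auto simp: e_def)
    then have eM: "e * M \<le> \<epsilon>" using \<open>M > 0\<close> by simp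
    have "isCont s x0" using lipschitz_on_continuous_on[OF s] W continuous_on_eq_continuous_at by blast
    then have Z_lim: "(Z \<longlongrightarrow> Z x0) (at x0)"
      unfolding Z_def by (intro tendsto_intros) (simp add: continuous_at)
    have "\<forall>\<^sub>F z in nhds (Z x0). norm (f z - f (Z x0) - f' (z - Z x0)) \<le> e * norm (z - Z x0)"
      using f \<open>e > 0\<close> unfolding has_derivative_at_alt eventually_nhds_metric dist_norm Z_def by blast
    from eventually_compose_filterlim[OF this Z_lim]
    have "\<forall>\<^sub>F x in at x0. norm (f (Z x) - f (Z x0) - f' (Z x - Z x0)) \<le> e * norm (Z x - Z x0)" .
    moreover have "\<forall>\<^sub>F z in nhds (Z x0). norm (g z - g (Z x0) - g' (z - Z x0)) \<le> e * norm (z - Z x0)"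
      using g \<open>e > 0\<close> unfolding has_derivative_at_alt eventually_nhds_metric dist_norm Z_def by blast
    from eventually_compose_filterlim[OF this Z_lim]
    have "\<forall>\<^sub>F x in at x0. norm (g (Z x) - g (Z x0) - g' (Z x - Z x0)) \<le> e * norm (Z x - Z x0)" .
    moreover have "\<forall>\<^sub>F x in at x0. dist (u x) (u x0) < e"
      using u(2) \<open>e > 0\<close> by (intro tendstoD) (simp_all add: continuous_at)
    moreover have "\<forall>\<^sub>F x in at x0. x \<in> W" using W by (intro eventually_at_in_open')
    ultimately show ?thesis
    proof eventually_elim
      case (elim x)
      define n where "n = (1 + L) * norm (x - x0)"
      define dz where "dz = Z x - Z x0"
      define rf where "rf = f (Z x) - f (Z x0) - f' dz"
      define rg where "rg = g (Z x) - g (Z x0) - g' dz"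
      have n0: "n \<ge> 0" using L0 by (simp add: n_def)
      have "norm dz \<le> norm (x - x0) + norm (s x - s x0)"
        using norm_Pair_le[of "x - x0" "s x - s x0"] by (simp add: dz_def Z_def)
      also have "\<dots> \<le> n" using lipschitz_onD[OF s elim(4) W(2)] by (simp add: n_def dist_norm algebra_simps)
      finally have dz: "norm dz \<le> n" .
      then have "e * norm dz \<le> e * n" using \<open>e > 0\<close> by simp
      then have rf: "\<bar>rf\<bar> \<le> e * n" and rg: "norm rg \<le> e * n"
        using elim(1,2) by (simp_all add: rf_def rg_def dz_def)
      have ud: "norm (u x - u x0) \<le> e" using elim(3) by (simp add: dist_norm)
      then have ux: "norm (u x) \<le> norm (u x0) + 1"
        using norm_triangle_sub[of "u x" "u x0"] \<open>e \<le> 1\<close> by linarith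
      have fstdz: "fst dz = x - x0" by (simp add: dz_def Z_def)
      have \<phi>d: "\<phi> x - \<phi> x0 = f (Z x) - f (Z x0)" using \<phi> elim(4) W(2) by (simp add: Z_def)
      \<comment> \<open>By these signs the increment of the Lagrangian with multiplier
        \<open>u x0\<close> lies below that of \<open>f\<close>, and the one with \<open>u x\<close>
        above. Only the upper bound pays for \<open>u x - u x0\<close>, as \<open>D\<close> is
        formed with \<open>u x0\<close>.\<close>
      have "u x0 \<bullet> g (Z x) \<le> 0" "u x \<bullet> g (Z x0) \<le> 0" "u x0 \<bullet> g (Z x0) = 0" "u x \<bullet> g (Z x) = 0"
        using u(1)[OF elim(4)] u(1)[OF W(2)] inner_vec_nonpos by (auto simp: Z_def)
      then have lower: "\<phi> x - \<phi> x0 \<ge> D (x - x0) + rf + u x0 \<bullet> rg"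
        and upper: "\<phi> x - \<phi> x0 \<le> D (x - x0) + rf + u x \<bullet> rg + (u x - u x0) \<bullet> g' dz"
        using D_eq[of dz] by (simp_all add: \<phi>d rf_def rg_def fstdz inner_diff_right inner_diff_left)
      have b1: "\<bar>u x0 \<bullet> rg\<bar> \<le> norm (u x0) * (e * n)"
        using mult_left_mono[OF rg norm_ge_zero[of "u x0"]] Cauchy_Schwarz_ineq2[of "u x0" rg] by linarith
      have b2: "\<bar>u x \<bullet> rg\<bar> \<le> (norm (u x0) + 1) * (e * n)"
        using ux rg n0 \<open>e > 0\<close> by (intro order_trans[OF Cauchy_Schwarz_ineq2] mult_mono) auto
      have "norm (g' dz) \<le> n * B" using B(2)[of dz] mult_right_mono[OF dz, of B] B(1) by linarith
      then have b3: "\<bar>(u x - u x0) \<bullet> g' dz\<bar> \<le> e * (n * B)"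
        using ud \<open>e > 0\<close> by (intro order_trans[OF Cauchy_Schwarz_ineq2] mult_mono) auto
      have "e * n \<ge> 0" "norm (u x0) * (e * n) \<ge> 0" "e * (n * B) \<ge> 0"
        using \<open>e > 0\<close> n0 B(1) by auto
      with lower upper b1 b2 b3 rf
      have "\<bar>\<phi> x - \<phi> x0 - D (x - x0)\<bar> \<le> e * n + norm (u x0) * (e * n) + (norm (u x0) + 1) * (e * n) + e * (n * B)"
        unfolding distrib_right by linarith
      also have "\<dots> = e * M * norm (x - x0)" by (simp add: M_def n_def algebra_simps)
      also have "\<dots> \<le> \<epsilon> * norm (x - x0)" using eM by (intro mult_right_mono) auto
      finally show ?case by simp
    qed
  qed
  ultimately show ?thesis unfolding has_derivative_within_alt2 D_def by blast
qed

section \<open>Coordinate derivatives of the Lagrangian\<close>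

lemma linear_real_vec_eq_inner:
  fixes T :: "real ^ 'n \<Rightarrow> real"
  assumes "linear T"
  shows "(\<chi> i. T (axis i 1)) \<bullet> d = T d"
proof -
  have "T d = T (\<Sum>i\<in>UNIV. d $ i *\<^sub>R axis i 1)"
    using basis_expansion[of d] by (simp add: scalar_mult_eq_scaleR)
  also have "\<dots> = (\<Sum>i\<in>UNIV. d $ i * T (axis i 1))"
    by (simp add: linear_sum[OF assms] linear_cmul[OF assms])
  finally show ?thesis by (simp add: inner_vec_def mult.commute)
qed

lemma partial_deriv_eq:
  "(h has_derivative h') (at x) \<Longrightarrow> partial_deriv i h x = h' (axis i 1)"
  unfolding partial_deriv_def by (metis frechet_derivative_at)

lemma gradient_eq_0_iff:
  assumes "(h has_derivative h') (at x)"
  shows "gradient h x = 0 \<longleftrightarrow> (\<forall>d. h' d = 0)"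
proof -
  have "gradient h x = (\<chi> i. h' (axis i 1))"
    by (simp add: gradient_def partial_deriv_eq[OF assms])
  moreover have "(\<chi> i. h' (axis i 1)) \<bullet> d = h' d" for d
    by (rule linear_real_vec_eq_inner[OF has_derivative_linear[OF assms]])
  ultimately show ?thesis by (metis inner_eq_zero_iff inner_zero_left)
qed

lemma jacobian_vector_mult:
  fixes h :: "real ^ 'n \<Rightarrow> real ^ 'm"
  assumes "(h has_derivative h') (at x)"
  shows "jacobian h (at x) *v d = h' d"
proof -
  have "h differentiable (at x)" using assms by (auto simp: differentiable_def)
  then have "(h has_derivative (\<lambda>d. jacobian h (at x) *v d)) (at x)" by (simp add: jacobian_works)
  from has_derivative_unique[OF this assms] show ?thesis by meson
qed

lemma has_derivative_partial_fst:
  assumes "(h has_derivative h') (at (x, y))"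
  shows "((\<lambda>x. h (x, y)) has_derivative (\<lambda>d. h' (d, 0))) (at x)"
  using has_derivative_compose[of "\<lambda>x. (x, y)" "\<lambda>d. (d, 0)" x UNIV h h'] assms
  by (simp add: has_derivative_Pair has_derivative_ident)

lemma has_derivative_partial_snd:
  assumes "(h has_derivative h') (at (x, y))"
  shows "((\<lambda>y. h (x, y)) has_derivative (\<lambda>d. h' (0, d))) (at y)"
  using has_derivative_compose[of "\<lambda>y. (x, y)" "\<lambda>d. (0, d)" y UNIV h h'] assms
  by (simp add: has_derivative_Pair has_derivative_ident)

lemma lagrangian_has_derivative_fst:
  fixes f :: "(real ^ 'n) \<times> (real ^ 'm) \<Rightarrow> real" and g :: "(real ^ 'n) \<times> (real ^ 'm) \<Rightarrow> real ^ 'p"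
  assumes "(f has_derivative f') (at (x, y))" and "(g has_derivative g') (at (x, y))"
  shows "((\<lambda>x. lagrangian f g x y u) has_derivative (\<lambda>d. f' (d, 0) + u \<bullet> g' (d, 0))) (at x)"
  unfolding lagrangian_def
  by (intro has_derivative_add has_derivative_inner_right has_derivative_partial_fst assms)

lemma lagrangian_has_derivative_snd:
  fixes f :: "(real ^ 'n) \<times> (real ^ 'm) \<Rightarrow> real" and g :: "(real ^ 'n) \<times> (real ^ 'm) \<Rightarrow> real ^ 'p"
  assumes "(f has_derivative f') (at (x, y))" and "(g has_derivative g') (at (x, y))"
  shows "((\<lambda>y. lagrangian f g x y u) has_derivative (\<lambda>d. f' (0, d) + u \<bullet> g' (0, d))) (at y)"
  unfolding lagrangian_def
  by (intro has_derivative_add has_derivative_inner_right has_derivative_partial_snd assms)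

lemma multiplier_map_iff:
  assumes "(f has_derivative f') (at (x, y))" and "(g has_derivative g') (at (x, y))"
  shows "u \<in> multiplier_map f g (x, y) \<longleftrightarrow>
    (\<forall>d. f' (0, d) + u \<bullet> g' (0, d) = 0) \<and> 0 \<le> u \<and> g (x, y) \<le> 0 \<and> u \<bullet> g (x, y) = 0"
  unfolding multiplier_map_def
  using gradient_eq_0_iff[OF lagrangian_has_derivative_snd[OF assms, of u]] by simp

lemma MFCQ_iff:
  assumes "(g has_derivative g') (at (x, y))"
  shows "MFCQ g x y \<longleftrightarrow>
    (\<forall>u. (\<forall>d. u \<bullet> g' (0, d) = 0) \<and> 0 \<le> u \<and> g (x, y) \<le> 0 \<and> u \<bullet> g (x, y) = 0 \<longrightarrow> u = 0)"
proof -
  have "transpose (jac_y g x y) *v u = 0 \<longleftrightarrow> (\<forall>d. u \<bullet> g' (0, d) = 0)" for u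
  proof -
    have "(transpose (jac_y g x y) *v u) \<bullet> d = u \<bullet> g' (0, d)" for d
      using jacobian_vector_mult[OF has_derivative_partial_snd[OF assms], of d]
      by (simp add: jac_y_def transpose_matrix_vector dot_lmul_matrix)
    then show ?thesis by (metis inner_eq_zero_iff inner_zero_left)
  qed
  then show ?thesis by (simp add: MFCQ_def)
qed

context
  fixes f :: "(real ^ 'n) \<times> (real ^ 'm) \<Rightarrow> real" and g :: "(real ^ 'n) \<times> (real ^ 'm) \<Rightarrow> real ^ 'p"
    and f' :: "(real ^ 'n) \<times> (real ^ 'm) \<Rightarrow> ((real ^ 'n) \<times> (real ^ 'm)) \<Rightarrow>\<^sub>L real"
    and g' :: "(real ^ 'n) \<times> (real ^ 'm) \<Rightarrow> ((real ^ 'n) \<times> (real ^ 'm)) \<Rightarrow>\<^sub>L (real ^ 'p)"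
    and f'' g''
  assumes f': "\<And>z. (f has_derivative f' z) (at z)" and g': "\<And>z. (g has_derivative g' z) (at z)"
    and f'': "\<And>z. (f' has_derivative blinfun_apply (f'' z)) (at z)"
    and g'': "\<And>z. (g' has_derivative blinfun_apply (g'' z)) (at z)"
begin

text \<open>Differentiating jointly in \<open>z\<close> at fixed \<open>u\<close> gives both Hessian
  blocks by restriction to the first or the second variable.\<close>

lemma partial_deriv_lagrangian_has_derivative:
  "((\<lambda>z. partial_deriv j (\<lambda>x. lagrangian f g x (snd z) u) (fst z)) has_derivative
     (\<lambda>d. f'' z d (axis j 1, 0) + u \<bullet> g'' z d (axis j 1, 0))) (at z)"
proof -
  have "partial_deriv j (\<lambda>x. lagrangian f g x (snd z) u) (fst z) = f' z (axis j 1, 0) + u \<bullet> g' z (axis j 1, 0)" for z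
    using partial_deriv_eq[OF lagrangian_has_derivative_fst, of f "f' z" "fst z" "snd z" g "g' z"] f' g' by simp
  then show ?thesis
    by (auto intro!: derivative_eq_intros f'' g'')
qed

text \<open>The arguments of \<open>f''\<close> follow the order of differentiation:
  \<open>d\<close> belongs to the outer derivative (row index), \<open>w\<close> to the inner one
  (column index).\<close>

lemma hess_xx_L_inner:
  "(hess_xx_L f g x y u *v w) \<bullet> d = f'' (x, y) (d, 0) (w, 0) + u \<bullet> g'' (x, y) (d, 0) (w, 0)"
proof -
  have lin: "linear (\<lambda>w. f'' (x, y) z (w, 0) + u \<bullet> g'' (x, y) z (w, 0))" for z
    by (intro bounded_linear.linear bounded_linear_intros)
  have "(hess_xx_L f g x y u *v w) $ i = f'' (x, y) (axis i 1, 0) (w, 0) + u \<bullet> g'' (x, y) (axis i 1, 0) (w, 0)" for i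
  proof -
    have "hess_xx_L f g x y u $ i = (\<chi> j. f'' (x, y) (axis i 1, 0) (axis j 1, 0) + u \<bullet> g'' (x, y) (axis i 1, 0) (axis j 1, 0))"
      using partial_deriv_eq[OF has_derivative_partial_fst[OF partial_deriv_lagrangian_has_derivative]]
      by (simp add: hess_xx_L_def vec_eq_iff)
    then show ?thesis
      using linear_real_vec_eq_inner[OF lin[of "(axis i 1, 0)"], of w] by (simp add: matrix_vector_mul_component)
  qed
  then have eq: "hess_xx_L f g x y u *v w = (\<chi> i. f'' (x, y) (axis i 1, 0) (w, 0) + u \<bullet> g'' (x, y) (axis i 1, 0) (w, 0))"
    by (simp add: vec_eq_iff)
  have lin_d: "linear (\<lambda>d. f'' (x, y) (d, 0) (w, 0) + u \<bullet> g'' (x, y) (d, 0) (w, 0))"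
    by (intro bounded_linear.linear bounded_linear_intros)
  show ?thesis unfolding eq by (rule linear_real_vec_eq_inner[OF lin_d])
qed

lemma hess_xy_L_inner:
  "(hess_xy_L f g x y u *v w) \<bullet> d = f'' (x, y) (0, d) (w, 0) + u \<bullet> g'' (x, y) (0, d) (w, 0)"
proof -
  have lin: "linear (\<lambda>w. f'' (x, y) z (w, 0) + u \<bullet> g'' (x, y) z (w, 0))" for z
    by (intro bounded_linear.linear bounded_linear_intros)
  have "(hess_xy_L f g x y u *v w) $ i = f'' (x, y) (0, axis i 1) (w, 0) + u \<bullet> g'' (x, y) (0, axis i 1) (w, 0)" for i
  proof -
    have "hess_xy_L f g x y u $ i = (\<chi> j. f'' (x, y) (0, axis i 1) (axis j 1, 0) + u \<bullet> g'' (x, y) (0, axis i 1) (axis j 1, 0))"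
      using partial_deriv_eq[OF has_derivative_partial_snd[OF partial_deriv_lagrangian_has_derivative]]
      by (simp add: hess_xy_L_def vec_eq_iff)
    then show ?thesis
      using linear_real_vec_eq_inner[OF lin[of "(0, axis i 1)"], of w] by (simp add: matrix_vector_mul_component)
  qed
  then have eq: "hess_xy_L f g x y u *v w = (\<chi> i. f'' (x, y) (0, axis i 1) (w, 0) + u \<bullet> g'' (x, y) (0, axis i 1) (w, 0))"
    by (simp add: vec_eq_iff)
  have lin_d: "linear (\<lambda>d. f'' (x, y) (0, d) (w, 0) + u \<bullet> g'' (x, y) (0, d) (w, 0))"
    by (intro bounded_linear.linear bounded_linear_intros)
  show ?thesis unfolding eq by (rule linear_real_vec_eq_inner[OF lin_d])
qed

end

text \<open>Composed with \<open>f'' z\<close>, it expresses the derivative of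
  \<open>\<lambda>z. f' z e\<close> as a bounded linear map depending continuously on
  \<open>z\<close>, the form required by \<open>has_derivative_strict\<close>.\<close>

definition blinfun_eval :: "'a::real_normed_vector \<Rightarrow> ('a \<Rightarrow>\<^sub>L 'b::real_normed_vector) \<Rightarrow>\<^sub>L 'b" where
  "blinfun_eval e = Blinfun (\<lambda>T. blinfun_apply T e)"

lemma blinfun_apply_eval [simp]: "blinfun_apply (blinfun_eval e) T = blinfun_apply T e"
  unfolding blinfun_eval_def by (simp add: bounded_linear_Blinfun_apply blinfun.bounded_linear_left)

text \<open>Composition with this inclusion restricts a total derivative to the directions of
  \<open>y\<close>.\<close>

definition blinfun_inr :: "'b \<Rightarrow>\<^sub>L ('a::real_normed_vector \<times> 'b::real_normed_vector)" where
  "blinfun_inr = Blinfun (\<lambda>d. (0, d))"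

lemma blinfun_apply_inr [simp]: "blinfun_apply blinfun_inr d = (0, d)"
  unfolding blinfun_inr_def
  by (simp add: bounded_linear_Blinfun_apply bounded_linear_Pair bounded_linear_zero bounded_linear_ident)

section \<open>The second-order inclusion for the value function\<close>

theorem theorem5p2:
  fixes f :: "(real ^ 'n) \<times> (real ^ 'm) \<Rightarrow> real"
    and g :: "(real ^ 'n) \<times> (real ^ 'm) \<Rightarrow> real ^ 'p"
    and s :: "real ^ 'n \<Rightarrow> real ^ 'm"
    and l :: "(real ^ 'n) \<times> (real ^ 'm) \<Rightarrow> real ^ 'p"
    and xbar :: "real ^ 'n" and ybar :: "real ^ 'm" and ubar :: "real ^ 'p"
    and xu xs :: "real ^ 'n"
  assumes "twice_continuously_differentiable f"
    and "twice_continuously_differentiable g"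
    and "compact (gph (feasible_map g))"
    and "\<And>y. y \<in> solution_map f g xbar \<Longrightarrow> MFCQ g xbar y"
    and "solution_map_single_lipschitz_around f g s xbar"
    and "ybar = s xbar"
    and "multiplier_map_single_lipschitz_around f g l (xbar, ybar)"
    and "ubar = l (xbar, ybar)"
    and "xu \<in> clarke_subdiff (value_function f g) xbar"
  shows "second_order_subdiff (value_function f g) xbar xu xs \<subseteq>
    (+) (hess_xx_L f g xbar ybar ubar *v xs) `
      (\<Union>(\<zeta>x, \<zeta>y) \<in> mordukhovich_subdiff (\<lambda>z. (jac_x g xbar ybar *v xs) \<bullet> l z) (xbar, ybar).
         (+) \<zeta>x ` mordukhovich_subdiff (\<lambda>x. (\<zeta>y + hess_xy_L f g xbar ybar ubar *v xs) \<bullet> s x) xbar)"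
proof
  fix v assume v: "v \<in> second_order_subdiff (value_function f g) xbar xu xs"
  obtain f' f'' where f': "\<And>z. (f has_derivative blinfun_apply (f' z)) (at z)"
    and f'': "\<And>z. (f' has_derivative blinfun_apply (f'' z)) (at z)" and f''_cont: "continuous_on UNIV f''"
    using assms(1) unfolding twice_continuously_differentiable_def by blast
  obtain g' g'' where g': "\<And>z. (g has_derivative blinfun_apply (g' z)) (at z)"
    and g'': "\<And>z. (g' has_derivative blinfun_apply (g'' z)) (at z)" and g''_cont: "continuous_on UNIV g''"
    using assms(2) unfolding twice_continuously_differentiable_def by blast
  have g_cont: "continuous_on UNIV g" and f'_cont: "continuous_on UNIV f'" and g'_cont: "continuous_on UNIV g'"
    by (rule has_derivative_continuous_on[OF has_derivative_at_withinI] g' f'' g'')+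
  obtain U L where U: "open U" "xbar \<in> U" "\<And>x. x \<in> U \<Longrightarrow> solution_map f g x = {s x}"
    and s_lip: "L-lipschitz_on U s"
    using assms(5) unfolding solution_map_single_lipschitz_around_def by blast
  define z0 where "z0 = (xbar, s xbar)"
  obtain V K where V: "open V" "z0 \<in> V"
    "\<And>z. z \<in> V \<Longrightarrow> multiplier_map f g z \<noteq> {} \<Longrightarrow> multiplier_map f g z = {l z}"
    and l_lip: "K-lipschitz_on V l"
    using assms(7) unfolding multiplier_map_single_lipschitz_around_def assms(6) z0_def by blast
  have L0: "L \<ge> 0" using s_lip lipschitz_on_nonneg by blast
  define Z where "Z x = (x, s x)" for x
  have Z_lip: "(1 + L)-lipschitz_on U Z" unfolding Z_def by (rule lipschitz_on_graph[OF s_lip])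
  have Z_z0: "Z xbar = z0" by (simp add: Z_def z0_def)
  have Z_conv: "(Z \<longlongrightarrow> z0) (nhds xbar)"
    using lipschitz_on_continuous_on[OF Z_lip] U continuous_on_eq_continuous_at Z_z0
    by (metis continuous_at tendsto_at_iff_tendsto_nhds)
  have sol: "g (x, s x) \<le> 0" "\<And>y. g (x, y) \<le> 0 \<Longrightarrow> f (x, s x) \<le> f (x, y)" if "x \<in> U" for x
  proof -
    have "s x \<in> solution_map f g x" using U(3)[OF that] by simp
    then show "g (x, s x) \<le> 0" "\<And>y. g (x, y) \<le> 0 \<Longrightarrow> f (x, s x) \<le> f (x, y)"
      by (auto simp: solution_map_def is_arg_min_linorder feasible_map_def)
  qed
  have value_eq: "value_function f g x = f (x, s x)" if "x \<in> U" for x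
    unfolding value_function_def
    by (rule Least_equality) (use sol[OF that] in \<open>auto simp: feasible_map_def\<close>)

  \<comment> \<open>Stated without feasibility of \<open>z\<close>, this condition is stable in all
    directions around \<open>z0\<close>; at \<open>z0\<close> it agrees with \<open>MFCQ\<close>
    because \<open>s xbar\<close> is feasible.\<close>
  define mfcq where "mfcq z \<longleftrightarrow> (\<forall>u. 0 \<le> u \<and> u \<bullet> g z = 0 \<and> (\<forall>d. u \<bullet> g' z (0, d) = 0) \<longrightarrow> u = 0)" for z
  have "s xbar \<in> solution_map f g xbar" using U by simp
  from assms(4)[OF this] have mfcq0: "mfcq z0"
    using sol(1)[OF U(2)] MFCQ_iff[OF g'] by (auto simp: mfcq_def z0_def)
  have "continuous_on UNIV (\<lambda>z. g' z o\<^sub>L blinfun_inr)"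
    by (intro continuous_intros g'_cont)
  from positive_linear_independence_open[OF g_cont this, of z0]
  have "\<forall>\<^sub>F z in nhds z0. mfcq z" using mfcq0 unfolding mfcq_def by simp
  then have "\<forall>\<^sub>F x in nhds xbar. mfcq (Z x) \<and> Z x \<in> V \<and> x \<in> U"
    using eventually_compose_filterlim[OF _ Z_conv] topological_tendstoD[OF Z_conv V(1,2)]
      eventually_nhds_in_open[OF U(1,2)] by (simp add: eventually_conj_iff)
  then obtain W0 where W0: "open W0" "xbar \<in> W0"
    "\<And>x. x \<in> W0 \<Longrightarrow> mfcq (Z x)" "\<And>x. x \<in> W0 \<Longrightarrow> Z x \<in> V" "\<And>x. x \<in> W0 \<Longrightarrow> x \<in> U"
    unfolding eventually_nhds by blast
  \<comment> \<open>Optimality of \<open>s x\<close> and \<open>mfcq\<close> produce some multiplier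
    at \<open>Z x\<close>; only then does the hypothesis on \<open>l\<close> identify it as
    \<open>l (Z x)\<close>.\<close>
  have multiplier: "l (Z x) \<in> multiplier_map f g (Z x)" if "x \<in> W0" for x
  proof -
    have F: "((\<lambda>y. f (x, y)) has_derivative (f' (x, y) o\<^sub>L blinfun_inr)) (at y)" for y
      by (rule has_derivative_eq_rhs[OF has_derivative_partial_snd[OF f']]) (simp add: fun_eq_iff)
    have G: "((\<lambda>y. g (x, y)) has_derivative (g' (x, y) o\<^sub>L blinfun_inr)) (at y)" for y
      by (rule has_derivative_eq_rhs[OF has_derivative_partial_snd[OF g']]) (simp add: fun_eq_iff)
    have "continuous_on UNIV (\<lambda>y. f' (x, y) o\<^sub>L blinfun_inr)" "continuous_on UNIV (\<lambda>y. g' (x, y) o\<^sub>L blinfun_inr)"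
      by (intro continuous_intros continuous_on_compose2[OF f'_cont] continuous_on_compose2[OF g'_cont]; simp)+
    then have cF: "isCont (\<lambda>y. f' (x, y) o\<^sub>L blinfun_inr) (s x)" and cG: "isCont (\<lambda>y. g' (x, y) o\<^sub>L blinfun_inr) (s x)"
      by (simp_all add: continuous_on_eq_continuous_at)
    have "x \<in> U" using W0(5) that .
    have nondegenerate: "u = 0"
      if "0 \<le> u" "u \<bullet> g (x, s x) = 0" "\<And>d. u \<bullet> (g' (x, s x) o\<^sub>L blinfun_inr) d = 0" for u
      using W0(3)[OF \<open>x \<in> W0\<close>] that by (simp add: mfcq_def Z_def)
    obtain u where "0 \<le> u" "u \<bullet> g (x, s x) = 0"
      "\<And>d. (f' (x, s x) o\<^sub>L blinfun_inr) d + u \<bullet> (g' (x, s x) o\<^sub>L blinfun_inr) d = 0"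
      using kkt_multiplier_exists[OF F G cF cG sol[OF \<open>x \<in> U\<close>] nondegenerate] by blast
    then have "u \<in> multiplier_map f g (Z x)"
      using multiplier_map_iff[OF f' g'] sol(1)[OF \<open>x \<in> U\<close>] by (simp add: Z_def)
    then show ?thesis using V(3)[OF W0(4)[OF that]] by auto
  qed

  \<comment> \<open>The derivative of the Lagrangian in the \<open>x\<close>-direction
    \<open>w\<close>, with multiplier \<open>l z\<close> inserted after differentiating.\<close>
  define F where "F w z = f' z (w, 0) + l z \<bullet> g' z (w, 0)" for w z
  define A' where "A' w z = blinfun_eval (w, 0) o\<^sub>L f'' z" for w :: "real ^ 'n" and z
  define B' where "B' w z = blinfun_eval (w, 0) o\<^sub>L g'' z" for w :: "real ^ 'n" and z
  have A': "((\<lambda>z. f' z (w, 0)) has_derivative A' w z) (at z)" for w z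
    by (rule has_derivative_eq_rhs[OF bounded_linear.has_derivative[OF blinfun.bounded_linear_left f'']])
      (simp add: A'_def fun_eq_iff)
  have B': "((\<lambda>z. g' z (w, 0)) has_derivative B' w z) (at z)" for w z
    by (rule has_derivative_eq_rhs[OF bounded_linear.has_derivative[OF blinfun.bounded_linear_left g'']])
      (simp add: B'_def fun_eq_iff)
  have "continuous_on UNIV (\<lambda>z. A' w z)" "continuous_on UNIV (\<lambda>z. B' w z)" for w
    unfolding A'_def B'_def by (intro continuous_intros f''_cont g''_cont)+
  then have A'_cont: "isCont (A' w) z" and B'_cont: "isCont (B' w) z" for w z
    using continuous_on_eq_continuous_at[OF open_UNIV] by blast+
  have strict: "\<exists>\<delta>>0. \<forall>x\<in>ball z0 \<delta>. \<forall>z\<in>ball z0 \<delta>.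
      \<bar>F w z - F w x - (A' w z0 (z - x) + l z0 \<bullet> B' w z0 (z - x)) - g' z0 (w, 0) \<bullet> (l z - l x)\<bar>
        \<le> \<epsilon> * norm (z - x)" if "\<epsilon> > 0" for \<epsilon> w
    unfolding F_def
    by (rule strict_derivative_add_inner[OF A'[of w] A'_cont B'[of w] B'_cont V(1,2) l_lip that])

  define h where "h x = (\<chi> i. F (axis i 1) (Z x))" for x
  have h_inner: "h x \<bullet> w = F w (Z x)" for x w
    unfolding h_def by (rule linear_real_vec_eq_inner)
      (auto intro!: bounded_linear.linear bounded_linear_intros simp: F_def)
  \<comment> \<open>The radius in \<open>strict\<close> depends on the direction \<open>w\<close>,
    but finitely many basis directions determine \<open>h\<close>.\<close>
  have "\<exists>\<delta>>0. \<exists>C. C-lipschitz_on (ball xbar \<delta>) h"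
  proof (rule lipschitz_near_componentwise)
    fix w :: "real ^ 'n"
    obtain \<delta> where \<delta>: "\<delta> > 0" "\<And>x z. x \<in> ball z0 \<delta> \<Longrightarrow> z \<in> ball z0 \<delta> \<Longrightarrow>
        \<bar>F w z - F w x - (A' w z0 (z - x) + l z0 \<bullet> B' w z0 (z - x)) - g' z0 (w, 0) \<bullet> (l z - l x)\<bar>
          \<le> 1 * norm (z - x)"
      using strict[OF zero_less_one, of w] by blast
    define C where "C = 1 + norm (A' w z0) + norm (l z0) * norm (B' w z0) + norm (g' z0 (w, 0)) * K"
    have K0: "K \<ge> 0" using l_lip lipschitz_on_nonneg by blast
    have F_lip: "C-lipschitz_on (ball z0 \<delta> \<inter> V) (F w)"
    proof (rule lipschitz_onI)
      show "C \<ge> 0" using K0 by (simp add: C_def)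
      fix z x assume zx: "z \<in> ball z0 \<delta> \<inter> V" "x \<in> ball z0 \<delta> \<inter> V"
      let ?n = "norm (z - x)"
      have "\<bar>A' w z0 (z - x)\<bar> \<le> norm (A' w z0) * ?n"
        using norm_blinfun[of "A' w z0" "z - x"] by simp
      moreover have "\<bar>l z0 \<bullet> B' w z0 (z - x)\<bar> \<le> norm (l z0) * (norm (B' w z0) * ?n)"
        by (intro order_trans[OF Cauchy_Schwarz_ineq2] mult_left_mono norm_blinfun norm_ge_zero)
      moreover have "\<bar>g' z0 (w, 0) \<bullet> (l z - l x)\<bar> \<le> norm (g' z0 (w, 0)) * (K * ?n)"
        using lipschitz_onD[OF l_lip] zx
        by (intro order_trans[OF Cauchy_Schwarz_ineq2] mult_left_mono) (auto simp: dist_norm)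
      ultimately have "\<bar>F w z - F w x\<bar> \<le> 1 * ?n + norm (A' w z0) * ?n
          + norm (l z0) * (norm (B' w z0) * ?n) + norm (g' z0 (w, 0)) * (K * ?n)"
        using \<delta>(2)[of x z] zx by auto
      then show "dist (F w z) (F w x) \<le> C * dist z x"
        by (simp add: C_def dist_norm algebra_simps)
    qed
    have "\<forall>\<^sub>F x in nhds xbar. Z x \<in> ball z0 \<delta> \<inter> V \<and> x \<in> U"
      using topological_tendstoD[OF Z_conv, of "ball z0 \<delta> \<inter> V"] V \<delta>(1)
        eventually_nhds_in_open[OF U(1,2)] by (auto simp: eventually_conj_iff)
    then obtain r where r: "r > 0" "\<And>x. x \<in> ball xbar r \<Longrightarrow> Z x \<in> ball z0 \<delta> \<inter> V \<and> x \<in> U"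
      unfolding eventually_nhds_metric by (auto simp: dist_commute)
    have "(C * (1 + L))-lipschitz_on (ball xbar r) (\<lambda>x. F w (Z x))"
      by (rule lipschitz_on_compose2[OF lipschitz_on_subset[OF Z_lip] lipschitz_on_subset[OF F_lip]])
        (use r(2) in auto)
    then show "\<exists>\<delta>>0. \<exists>C. C-lipschitz_on (ball xbar \<delta>) (\<lambda>x. w \<bullet> h x)"
      using r(1) by (auto simp: h_inner inner_commute[of w])
  qed
  then obtain \<delta> C where \<delta>: "\<delta> > 0" and "C-lipschitz_on (ball xbar \<delta>) h" by blast
  define W where "W = W0 \<inter> ball xbar \<delta>"
  have W: "open W" "xbar \<in> W" using W0 \<delta> by (auto simp: W_def)
  have h_lip: "C-lipschitz_on W h"
    using lipschitz_on_subset[OF \<open>C-lipschitz_on (ball xbar \<delta>) h\<close>] by (simp add: W_def)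
  have deriv: "(value_function f g has_derivative (\<lambda>d. h x \<bullet> d)) (at x)" if "x \<in> W" for x
  proof -
    have mult: "(\<forall>d. f' (Z x) (0, d) + l (Z x) \<bullet> g' (Z x) (0, d) = 0) \<and> 0 \<le> l (Z x) \<and> g (Z x) \<le> 0
        \<and> l (Z x) \<bullet> g (Z x) = 0" if "x \<in> W" for x
      using multiplier[of x] multiplier_map_iff[OF f' g'] that by (simp add: W_def Z_def)
    have "isCont Z x" "isCont l (Z x)"
      using lipschitz_on_continuous_on[OF Z_lip] lipschitz_on_continuous_on[OF l_lip] U(1) V(1)
        W0(4,5) that continuous_on_eq_continuous_at by (metis IntD1 W_def)+
    then have cont: "isCont (\<lambda>x. l (Z x)) x" by (rule isCont_o2)
    have "(value_function f g has_derivative (\<lambda>d. f' (x, s x) (d, 0) + l (Z x) \<bullet> g' (x, s x) (d, 0))) (at x)"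
    proof (rule value_has_derivative[OF f' g' W(1) that])
      show "L-lipschitz_on W s" by (rule lipschitz_on_subset[OF s_lip]) (use W0(5) in \<open>auto simp: W_def\<close>)
      show "0 \<le> l (Z x) \<and> g (x, s x) \<le> 0 \<and> l (Z x) \<bullet> g (x, s x) = 0" if "x \<in> W" for x
        using mult[OF that] by (simp add: Z_def)
      show "f' (x, s x) (0, d) + l (Z x) \<bullet> g' (x, s x) (0, d) = 0" for d
        using mult[OF that] by (simp add: Z_def)
      show "value_function f g x = f (x, s x)" if "x \<in> W" for x
        using value_eq W0(5) that by (simp add: W_def)
    qed (rule cont)
    then show ?thesis by (simp add: h_inner F_def Z_def)
  qed
  have clarke: "clarke_subdiff (value_function f g) x = {h x}" if "x \<in> W" for x
    unfolding clarke_subdiff_def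
    using mordukhovich_subdiff_C1[OF W(1) that deriv lipschitz_on_continuous_on[OF h_lip]] by simp
  have "limiting_subgradient (\<lambda>x. xs \<bullet> h x) xbar v"
    using v by (intro coderivative_imp_limiting_subgradient[OF W clarke h_lip]) (auto simp: second_order_subdiff_def)
  then have lim_v: "limiting_subgradient (\<lambda>x. F xs (Z x)) xbar v"
    by (simp add: inner_commute[of xs] h_inner)

  define a where "a = hess_xx_L f g xbar ybar ubar *v xs"
  define b where "b = hess_xy_L f g xbar ybar ubar *v xs"
  define w where "w = jac_x g xbar ybar *v xs"
  \<comment> \<open>Splitting \<open>d\<close> into its two components identifies the linear part
    frozen at \<open>z0\<close> with the two Hessian blocks applied to \<open>xs\<close>.\<close>
  have ab: "A' xs z0 d + l z0 \<bullet> B' xs z0 d = a \<bullet> fst d + b \<bullet> snd d" for d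
  proof -
    have "A' xs z0 d + l z0 \<bullet> B' xs z0 d =
      f'' z0 ((fst d, 0) + (0, snd d)) (xs, 0) + l z0 \<bullet> g'' z0 ((fst d, 0) + (0, snd d)) (xs, 0)"
      by (simp add: A'_def B'_def)
    also have "\<dots> = a \<bullet> fst d + b \<bullet> snd d"
      unfolding a_def b_def hess_xx_L_inner[OF f' g' f'' g''] hess_xy_L_inner[OF f' g' f'' g'']
        blinfun.add_right blinfun.add_left inner_add_right assms(6,8) z0_def by simp
    finally show ?thesis .
  qed
  have w: "g' z0 (xs, 0) = w"
    using jacobian_vector_mult[OF has_derivative_partial_fst[OF g']] by (simp add: w_def jac_x_def z0_def assms(6))
  \<comment> \<open>The term of \<open>a\<close> is linear in \<open>x\<close> and is split off. The
    term of \<open>b\<close> stays, because it meets the nonsmooth \<open>s\<close> after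
    substitution and must pass through the chain rule.\<close>
  define q where "q z = b \<bullet> snd z + w \<bullet> l z" for z
  have "limiting_subgradient (\<lambda>x. q (x, s x)) xbar (v + - a)"
  proof (rule limiting_subgradient_strict_perturb[OF lim_v])
    fix \<epsilon> :: real assume "\<epsilon> > 0"
    \<comment> \<open>The estimate in \<open>z\<close> is pulled back along \<open>Z\<close>, which
      has Lipschitz constant \<open>1 + L\<close>.\<close>
    then have "\<epsilon> / (1 + L) > 0" using L0 by simp
    from strict[OF this, of xs] obtain \<delta> where \<delta>: "\<delta> > 0" "\<And>x z. x \<in> ball z0 \<delta> \<Longrightarrow> z \<in> ball z0 \<delta> \<Longrightarrow>
        \<bar>F xs z - F xs x - (a \<bullet> fst (z - x) + b \<bullet> snd (z - x)) - w \<bullet> (l z - l x)\<bar> \<le> \<epsilon> / (1 + L) * norm (z - x)"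
      unfolding ab w by blast
    have "\<forall>\<^sub>F x in nhds xbar. Z x \<in> ball z0 \<delta> \<and> x \<in> U"
      using topological_tendstoD[OF Z_conv, of "ball z0 \<delta>"] \<delta>(1)
        eventually_nhds_in_open[OF U(1,2)] by (auto simp: eventually_conj_iff)
    then obtain r where r: "r > 0" "\<And>x. x \<in> ball xbar r \<Longrightarrow> Z x \<in> ball z0 \<delta> \<and> x \<in> U"
      unfolding eventually_nhds_metric by (auto simp: dist_commute)
    have "\<bar>q (z, s z) - q (x, s x) - (F xs (Z z) - F xs (Z x)) - - a \<bullet> (z - x)\<bar> \<le> \<epsilon> * norm (z - x)"
      if "x \<in> ball xbar r" "z \<in> ball xbar r" for x z
    proof -
      have "\<bar>q (z, s z) - q (x, s x) - (F xs (Z z) - F xs (Z x)) - - a \<bullet> (z - x)\<bar> =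
        \<bar>F xs (Z z) - F xs (Z x) - (a \<bullet> fst (Z z - Z x) + b \<bullet> snd (Z z - Z x)) - w \<bullet> (l (Z z) - l (Z x))\<bar>"
        by (subst abs_minus_cancel[symmetric]) (simp add: q_def Z_def inner_diff_right)
      also have "\<dots> \<le> \<epsilon> / (1 + L) * norm (Z z - Z x)" using \<delta>(2) r(2) that by blast
      also have "\<dots> \<le> \<epsilon> / (1 + L) * ((1 + L) * norm (z - x))"
        using lipschitz_onD[OF Z_lip] r(2) that \<open>\<epsilon> / (1 + L) > 0\<close>
        by (intro mult_left_mono) (auto simp: dist_norm)
      also have "\<dots> = \<epsilon> * norm (z - x)" using L0 by simp
      finally show ?thesis .
    qed
    with r(1) show "\<exists>\<delta>>0. \<forall>x\<in>ball xbar \<delta>. \<forall>z\<in>ball xbar \<delta>.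
        \<bar>q (z, s z) - q (x, s x) - (F xs (Z z) - F xs (Z x)) - - a \<bullet> (z - x)\<bar> \<le> \<epsilon> * norm (z - x)"
      by blast
  qed
  moreover have "(norm b * 1 + norm w * K)-lipschitz_on V q"
    unfolding q_def
    by (intro lipschitz_on_add lipschitz_on_inner_const l_lip lipschitz_onI) (auto simp: dist_snd_le)
  ultimately obtain \<zeta> where \<zeta>: "limiting_subgradient q z0 \<zeta>"
    "limiting_subgradient (\<lambda>x. snd \<zeta> \<bullet> s x) xbar (v + - a - fst \<zeta>)"
    using limiting_subgradient_chain[OF U(1) s_lip U(2) V(1) _ V(2)[unfolded z0_def]] unfolding z0_def by blast
  \<comment> \<open>\<open>q\<close> and \<open>\<langle>w, l\<rangle>\<close> differ by an exactly
    linear function, so any radius works. The shift by \<open>(0, - b)\<close> is the source of the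
    sum of \<open>\<zeta>y\<close> and the mixed Hessian term in the conclusion.\<close>
  have "limiting_subgradient (\<lambda>z. w \<bullet> l z) z0 (\<zeta> + (0, - b))"
  proof (rule limiting_subgradient_strict_perturb[OF \<zeta>(1)])
    fix \<epsilon> :: real assume "\<epsilon> > 0"
    then show "\<exists>\<delta>>0. \<forall>x\<in>ball z0 \<delta>. \<forall>z\<in>ball z0 \<delta>.
        \<bar>w \<bullet> l z - w \<bullet> l x - (q z - q x) - (0, - b) \<bullet> (z - x)\<bar> \<le> \<epsilon> * norm (z - x)"
      by (intro exI[of _ 1]) (simp add: q_def inner_prod_def inner_diff_right)
  qed
  moreover have "continuous_on V (\<lambda>z. w \<bullet> l z)"
    by (intro continuous_intros lipschitz_on_continuous_on[OF l_lip])
  ultimately have "\<zeta> + (0, - b) \<in> mordukhovich_subdiff (\<lambda>z. w \<bullet> l z) z0"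
    by (intro limiting_subgradient_imp_mordukhovich[OF V(1,2)])
  then have \<zeta>_mem: "(fst \<zeta>, snd \<zeta> - b) \<in> mordukhovich_subdiff (\<lambda>z. w \<bullet> l z) (xbar, ybar)"
    by (simp add: z0_def assms(6) prod_eq_iff plus_prod_def)
  have "continuous_on U (\<lambda>x. snd \<zeta> \<bullet> s x)"
    by (intro continuous_intros lipschitz_on_continuous_on[OF s_lip])
  with \<zeta>(2) have "v - a - fst \<zeta> \<in> mordukhovich_subdiff (\<lambda>x. ((snd \<zeta> - b) + b) \<bullet> s x) xbar"
    using limiting_subgradient_imp_mordukhovich[OF U(1,2)] by simp
  then have "v - a \<in> (+) (fst \<zeta>) ` mordukhovich_subdiff (\<lambda>x. ((snd \<zeta> - b) + b) \<bullet> s x) xbar"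
    by (rule rev_image_eqI) simp
  with \<zeta>_mem have "v - a \<in> (\<Union>(\<zeta>x, \<zeta>y) \<in> mordukhovich_subdiff (\<lambda>z. w \<bullet> l z) (xbar, ybar).
      (+) \<zeta>x ` mordukhovich_subdiff (\<lambda>x. (\<zeta>y + b) \<bullet> s x) xbar)"
    by (intro UN_I) auto
  then show "v \<in> (+) (hess_xx_L f g xbar ybar ubar *v xs) `
      (\<Union>(\<zeta>x, \<zeta>y) \<in> mordukhovich_subdiff (\<lambda>z. (jac_x g xbar ybar *v xs) \<bullet> l z) (xbar, ybar).
         (+) \<zeta>x ` mordukhovich_subdiff (\<lambda>x. (\<zeta>y + hess_xy_L f g xbar ybar ubar *v xs) \<bullet> s x) xbar)"
    unfolding a_def[symmetric] b_def[symmetric] w_def[symmetric]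
    by (rule rev_image_eqI) simp
qed

end
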